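(* Consider the two-player single-controller constrained stochastic game $G^c$ with discounted cost criterion, with discount factor $\beta\in[0,1)$, described in the context. Let $\eta=(u^T,z^T,f^T,x^T,(\delta^1)^T,(\delta^2)^T)^T$ with $u=(u(s))_{s\in S}$, $z=(z(s))_{s\in S}$, $f=(f(s,a^1))_{(s,a^1)\in\mathcal{K}^1}$, $x=(x(s,a^2))_{(s,a^2)\in\mathcal{K}^2}$, $\delta^1=(\delta^1_k)_{k=1}^{n_1}$, $\delta^2=(\delta^2_l)_{l=1}^{n_2}$ real vectors, and let [MP2] be the problem of minimizing $$\Phi(\eta)=\Big[\sum_{s\in S}\sum_{a^1\in A^1(s)}\sum_{a^2\in A^2(s)} f(s,a^1)c^1(s,a^1,a^2)x(s,a^2)-\Big(\sum_{s\in S}z(s)-\sum_{k=1}^{n_1}\delta^1_k\xi^1_k\Big)\Big]+\Big[\sum_{s\in S}\sum_{a^1\in A^1(s)}\sum_{a^2\in A^2(s)} f(s,a^1)c^2(s,a^1,a^2)x(s,a^2)-\Big((1-\beta)\sum_{s\in S}\gamma(s)u(s)-\sum_{l=1}^{n_2}\delta^2_l\xi^2_l\Big)\Big]$$ over all $\eta$ subject to (i) $u(s)\le \sum_{a^1\in A^1(s)}f(s,a^1)c^2(s,a^1,a^2)+\sum_{l=1}^{n_2}\delta^2_l\sum_{a^1\in A^1(s)}f(s,a^1)d^{2,l}(s,a^1,a^2)+\beta\sum_{s'\in S}p(s'|s,a^2)u(s')$ for all $s\in S$, $a^2\in A^2(s)$; (ii) $z(s)\le\sum_{a^2\in A^2(s)}c^1(s,a^1,a^2)x(s,a^2)+\sum_{k=1}^{n_1}\delta^1_k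 d^{1,k}_{sub}(s,a^1)$ for all $s\in S$, $a^1\in A^1(s)$; (iii) $\sum_{(s,a^2)\in\mathcal{K}^2}[\delta(s,s')-\beta p(s'|s,a^2)]x(s,a^2)=(1-\beta)\gamma(s')$ for all $s'\in S$; (iv) $\sum_{(s,a^1)\in\mathcal{K}^1}d^{1,k}_{sub}(s,a^1)f(s,a^1)\le\xi^1_k$ for all $k=1,\dots,n_1$; (v) $\sum_{s\in S}\sum_{a^1\in A^1(s)}\sum_{a^2\in A^2(s)}f(s,a^1)d^{2,l}(s,a^1,a^2)x(s,a^2)\le\xi^2_l$ for all $l=1,\dots,n_2$; (vi) $\sum_{a^1\in A^1(s)}f(s,a^1)=1$ for all $s\in S$; (vii) $f(s,a^1)\ge0$ for all $s\in S$, $a^1\in A^1(s)$; (viii) $x(s,a^2)\ge0$ for all $s\in S$, $a^2\in A^2(s)$; (ix) $\delta^1_k\ge0$ for all $k=1,\dots,n_1$; (x) $\delta^2_l\ge0$ for all $l=1,\dots,n_2$. Then: (a) If $(f^*,g^* )$ is a (stationary) Nash equilibrium of $G^c$ with discounted cost criterion, then there exists a vector $\eta^*=(u^{*T},z^{*T},f^{*T},x^{*T},(\delta^{1*})^T,(\delta^{2*})^T)^T$ (whose $f$-component is the given $f^*$) that is a global minimum of [MP2] with $\Phi(\eta^* )=0$. (b) If $\eta^*=(u^{*T},z^{*T},f^{*T},x^{*T},(\delta^{1*})^T,(\delta^{2*})^T)^T$ is a global minimum of [MP2] with $\Phi(\eta^* )=0$, then $(f^*,g^* )$ is a Nash equilibrium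 of $G^c$ with discounted cost criterion, where for all $s\in S$, $a^2\in A^2(s)$ $$g^*(s,a^2)=\frac{x^*(s,a^2)}{\sum_{b\in A^2(s)}x^*(s,b)}$$ whenever the denominator is nonzero (when it is zero, $g^*(s)$ is chosen arbitrarily from the probability measures on $A^2(s)$).
   Context: Game data. $S$ is a finite state space; $\gamma$ is a probability distribution on $S$ (initial distribution); for $i=1,2$ and $s\in S$, $A^i(s)$ is the finite nonempty set of actions of player $i$ at $s$. Put $\mathcal{K}=\{(s,a^1,a^2):s\in S,a^1\in A^1(s),a^2\in A^2(s)\}$ and $\mathcal{K}^i=\{(s,a^i):s\in S,a^i\in A^i(s)\}$. Given are: immediate costs $c^i:\mathcal{K}\to\mathbb{R}$, $i=1,2$; subscription costs $d^{1,k}_{sub}:\mathcal{K}^1\to\mathbb{R}$, $k=1,\dots,n_1$, of player 1; constraint costs $d^{2,l}:\mathcal{K}\to\mathbb{R}$, $l=1,\dots,n_2$, of player 2; bounds $\xi^1_k,\xi^2_l\in\mathbb{R}$; and transition probabilities $p(\cdot|s,a^2)$, a probability measure on $S$ for each $(s,a^2)\in\mathcal{K}^2$ (only player 2 controls the transitions). $\delta(s,s')$ is the Kronecker delta. Strategies. At each time $t=0,1,2,\dots$ both players observe the state and independently choose actions. A history-dependent (behavioral) strategy of a player assigns to each history $(s_0,a^1_0,a^2_0,\dots,s_{t-1},a^1_{t-1},a^2_{t-1},s_t)$ a probability measure on that player's actions at $s_t$. A stationary strategy of player 1 is $f=(f(s,a^1))$ with $f(s,\cdot)$ a probability measure on $A^1(s)$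 for each $s$; a stationary strategy of player 2 is $g=(g(s,a^2))$ similarly. The sets of stationary strategies are $F_S$ and $G_S$. With the initial distribution $\gamma$ and a strategy pair, let $\mathbb{E}$ be the expectation for the induced process $\{X_t,\mathbb{A}^1_t,\mathbb{A}^2_t\}_{t\ge0}$ of states and actions. Costs and constraints (discounted criterion). Fix $\beta\in[0,1)$. For $f\in F_S$ and any history-dependent strategy $g^h$ of player 2, $$C^i(\gamma,f,g^h)=(1-\beta)\sum_{t=0}^{\infty}\beta^t\,\mathbb{E}^\gamma_{f,g^h}c^i(X_t,\mathbb{A}^1_t,\mathbb{A}^2_t),\qquad D^{2,l}(\gamma,f,g^h)=(1-\beta)\sum_{t=0}^{\infty}\beta^t\,\mathbb{E}^\gamma_{f,g^h}d^{2,l}(X_t,\mathbb{A}^1_t,\mathbb{A}^2_t).$$ The pair $(f,g^h)$ is 1-feasible if $\sum_{s\in S}\sum_{a^1\in A^1(s)}d^{1,k}_{sub}(s,a^1)f(s,a^1)\le\xi^1_k$ for all $k=1,\dots,n_1$; it is 2-feasible if $D^{2,l}(\gamma,f,g^h)\le\xi^2_l$ for all $l=1,\dots,n_2$; it is feasible if both hold. Nash equilibrium. A feasible pair $(f^*,g^* )\in F_S\times G_S$ is a Nash equilibrium of $G^c$ if $C^1(\gamma,f^*,g^* )\le C^1(\gamma,f,g^* )$ for every $f\in F_S$ with $(f,g^* )$ 1-feasible, and $C^2(\gamma,f^*,g^* )\le C^2(\gamma,f^*,g^h)$ for every history-dependent $g^h$ with $(f^*,g^h)$ 2-feasible. Standing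 assumptions. The set of feasible stationary pairs is nonempty. Strong Slater condition: there exists $g'\in G_S$ such that for every $f\in F_S$, $D^{2,l}(\gamma,f,g')<\xi^2_l$ for all $l=1,\dots,n_2$. A global minimum of [MP2] means a feasible point at which $\Phi$ is minimal over all feasible points. *)

theory Defs
  imports "HOL-Probability.Probability"
begin

text \<open>
  Two-player constrained stochastic games with a single controller. The finite state space is
  a type of class \<open>finite\<close>; a state-dependent action set \<open>A s\<close> is a set over an arbitrary type.
  Functions on the set of admissible state-action pairs are total functions of which only the
  values at admissible arguments matter. Constraints are indexed by \<open>{1..n}\<close>, and \<open>n = 0\<close> is
  allowed. Only player 2's action enters \<open>transition\<close>.
\<close>

record ('s, 'a, 'b) game =
  init :: "'s pmf"
  act1 :: "'s \<Rightarrow> 'a set"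
  act2 :: "'s \<Rightarrow> 'b set"
  cost1 :: "'s \<Rightarrow> 'a \<Rightarrow> 'b \<Rightarrow> real"
  cost2 :: "'s \<Rightarrow> 'a \<Rightarrow> 'b \<Rightarrow> real"
  num1 :: nat
  num2 :: nat
  dsub1 :: "nat \<Rightarrow> 's \<Rightarrow> 'a \<Rightarrow> real"
  dcost2 :: "nat \<Rightarrow> 's \<Rightarrow> 'a \<Rightarrow> 'b \<Rightarrow> real"
  bound1 :: "nat \<Rightarrow> real"
  bound2 :: "nat \<Rightarrow> real"
  transition :: "'s \<Rightarrow> 'b \<Rightarrow> 's pmf"
  disc :: real

definition valid_game :: "('s::finite, 'a, 'b) game \<Rightarrow> bool" where
  "valid_game G \<longleftrightarrow>
     0 \<le> disc G \<and> disc G < 1 \<and>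
     (\<forall>s. finite (act1 G s) \<and> act1 G s \<noteq> {}) \<and>
     (\<forall>s. finite (act2 G s) \<and> act2 G s \<noteq> {})"

text \<open>
  A history \<open>(s\<^sub>0, a\<^sub>0, b\<^sub>0, \<dots>, s\<^sub>t\<^sub>-\<^sub>1, a\<^sub>t\<^sub>-\<^sub>1, b\<^sub>t\<^sub>-\<^sub>1, s\<^sub>t)\<close> is the pair of the
  chronological list of its first \<open>t\<close> triples and the current state \<open>s\<^sub>t\<close>.
\<close>

type_synonym ('s, 'a, 'b) past = "('s \<times> 'a \<times> 'b) list"

definition admissible :: "('s::finite, 'a, 'b) game \<Rightarrow> ('s \<times> 'a \<times> 'b) set" where
  "admissible G = {(s, a, b). a \<in> act1 G s \<and> b \<in> act2 G s}"

definition stationary1 :: "('s::finite, 'a, 'b) game \<Rightarrow> ('s \<Rightarrow> 'a pmf) set" where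
  "stationary1 G = {f. \<forall>s. set_pmf (f s) \<subseteq> act1 G s}"

definition stationary2 :: "('s::finite, 'a, 'b) game \<Rightarrow> ('s \<Rightarrow> 'b pmf) set" where
  "stationary2 G = {g. \<forall>s. set_pmf (g s) \<subseteq> act2 G s}"

definition behavioral2 ::
  "('s::finite, 'a, 'b) game \<Rightarrow> (('s, 'a, 'b) past \<Rightarrow> 's \<Rightarrow> 'b pmf) set" where
  "behavioral2 G =
     {gh. \<forall>h s. set h \<subseteq> admissible G \<longrightarrow> set_pmf (gh h s) \<subseteq> act2 G s}"

text \<open>
  \<open>history_law G f gh t\<close> is the law of the history up to time \<open>t\<close> of the process induced by the
  initial distribution, player 1's stationary strategy \<open>f\<close> and player 2's history-dependent
  strategy \<open>gh\<close>. \<open>triple_law\<close> is the law of \<open>(X\<^sub>t, \<bbbA>\<^sup>1\<^sub>t, \<bbbA>\<^sup>2\<^sub>t)\<close>; the two players randomise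
  independently given the history.
\<close>

primrec history_law ::
  "('s::finite, 'a, 'b) game \<Rightarrow> ('s \<Rightarrow> 'a pmf) \<Rightarrow> (('s, 'a, 'b) past \<Rightarrow> 's \<Rightarrow> 'b pmf) \<Rightarrow>
     nat \<Rightarrow> (('s, 'a, 'b) past \<times> 's) pmf" where
  "history_law G f gh 0 = map_pmf (\<lambda>s. ([], s)) (init G)"
| "history_law G f gh (Suc t) =
     bind_pmf (history_law G f gh t) (\<lambda>(h, s).
     bind_pmf (f s) (\<lambda>a.
     bind_pmf (gh h s) (\<lambda>b.
     map_pmf (\<lambda>s'. (h @ [(s, a, b)], s')) (transition G s b))))"

definition triple_law ::
  "('s::finite, 'a, 'b) game \<Rightarrow> ('s \<Rightarrow> 'a pmf) \<Rightarrow> (('s, 'a, 'b) past \<Rightarrow> 's \<Rightarrow> 'b pmf) \<Rightarrow>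
     nat \<Rightarrow> ('s \<times> 'a \<times> 'b) pmf" where
  "triple_law G f gh t =
     bind_pmf (history_law G f gh t) (\<lambda>(h, s).
     map_pmf (\<lambda>(a, b). (s, a, b)) (pair_pmf (f s) (gh h s)))"

definition discounted ::
  "('s::finite, 'a, 'b) game \<Rightarrow> ('s \<Rightarrow> 'a \<Rightarrow> 'b \<Rightarrow> real) \<Rightarrow>
     ('s \<Rightarrow> 'a pmf) \<Rightarrow> (('s, 'a, 'b) past \<Rightarrow> 's \<Rightarrow> 'b pmf) \<Rightarrow> real" where
  "discounted G c f gh =
     (1 - disc G) *
     (\<Sum>t. disc G ^ t *
        measure_pmf.expectation (triple_law G f gh t) (\<lambda>(s, a, b). c s a b))"

definition feasible1 :: "('s::finite, 'a, 'b) game \<Rightarrow> ('s \<Rightarrow> 'a pmf) \<Rightarrow> bool" where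
  "feasible1 G f \<longleftrightarrow>
     (\<forall>k\<in>{1..num1 G}. (\<Sum>s\<in>UNIV. \<Sum>a\<in>act1 G s. dsub1 G k s a * pmf (f s) a) \<le> bound1 G k)"

definition feasible2 ::
  "('s::finite, 'a, 'b) game \<Rightarrow> ('s \<Rightarrow> 'a pmf) \<Rightarrow> (('s, 'a, 'b) past \<Rightarrow> 's \<Rightarrow> 'b pmf) \<Rightarrow> bool" where
  "feasible2 G f gh \<longleftrightarrow>
     (\<forall>l\<in>{1..num2 G}. discounted G (dcost2 G l) f gh \<le> bound2 G l)"

text \<open>A stationary strategy \<open>g\<close> of player 2 is embedded as \<open>\<lambda>_. g\<close>, which ignores the past.\<close>

definition feasible_pair ::
  "('s::finite, 'a, 'b) game \<Rightarrow> ('s \<Rightarrow> 'a pmf) \<Rightarrow> ('s \<Rightarrow> 'b pmf) \<Rightarrow> bool" where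
  "feasible_pair G f g \<longleftrightarrow> feasible1 G f \<and> feasible2 G f (\<lambda>_. g)"

definition strong_slater :: "('s::finite, 'a, 'b) game \<Rightarrow> bool" where
  "strong_slater G \<longleftrightarrow>
     (\<exists>g'\<in>stationary2 G. \<forall>f\<in>stationary1 G. \<forall>l\<in>{1..num2 G}.
        discounted G (dcost2 G l) f (\<lambda>_. g') < bound2 G l)"

definition nash_equilibrium ::
  "('s::finite, 'a, 'b) game \<Rightarrow> ('s \<Rightarrow> 'a pmf) \<Rightarrow> ('s \<Rightarrow> 'b pmf) \<Rightarrow> bool" where
  "nash_equilibrium G f g \<longleftrightarrow>
     f \<in> stationary1 G \<and> g \<in> stationary2 G \<and> feasible_pair G f g \<and>
     (\<forall>f'\<in>stationary1 G. feasible1 G f' \<longrightarrow>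
        discounted G (cost1 G) f (\<lambda>_. g) \<le> discounted G (cost1 G) f' (\<lambda>_. g)) \<and>
     (\<forall>gh\<in>behavioral2 G. feasible2 G f gh \<longrightarrow>
        discounted G (cost2 G) f (\<lambda>_. g) \<le> discounted G (cost2 G) f gh)"

record ('s, 'a, 'b) mp_vec =
  vec_u :: "'s \<Rightarrow> real"
  vec_z :: "'s \<Rightarrow> real"
  vec_f :: "'s \<Rightarrow> 'a \<Rightarrow> real"
  vec_x :: "'s \<Rightarrow> 'b \<Rightarrow> real"
  vec_d1 :: "nat \<Rightarrow> real"
  vec_d2 :: "nat \<Rightarrow> real"

definition mp_objective :: "('s::finite, 'a, 'b) game \<Rightarrow> ('s, 'a, 'b) mp_vec \<Rightarrow> real" where
  "mp_objective G \<eta> =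
     ((\<Sum>s\<in>UNIV. \<Sum>a\<in>act1 G s. \<Sum>b\<in>act2 G s. vec_f \<eta> s a * cost1 G s a b * vec_x \<eta> s b)
       - ((\<Sum>s\<in>UNIV. vec_z \<eta> s) - (\<Sum>k=1..num1 G. vec_d1 \<eta> k * bound1 G k)))
   + ((\<Sum>s\<in>UNIV. \<Sum>a\<in>act1 G s. \<Sum>b\<in>act2 G s. vec_f \<eta> s a * cost2 G s a b * vec_x \<eta> s b)
       - ((1 - disc G) * (\<Sum>s\<in>UNIV. pmf (init G) s * vec_u \<eta> s)
          - (\<Sum>l=1..num2 G. vec_d2 \<eta> l * bound2 G l)))"

definition mp_feasible :: "('s::finite, 'a, 'b) game \<Rightarrow> ('s, 'a, 'b) mp_vec \<Rightarrow> bool" where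
  "mp_feasible G \<eta> \<longleftrightarrow>
     (\<forall>s. \<forall>b\<in>act2 G s.
        vec_u \<eta> s \<le> (\<Sum>a\<in>act1 G s. vec_f \<eta> s a * cost2 G s a b)
          + (\<Sum>l=1..num2 G. vec_d2 \<eta> l * (\<Sum>a\<in>act1 G s. vec_f \<eta> s a * dcost2 G l s a b))
          + disc G * (\<Sum>s'\<in>UNIV. pmf (transition G s b) s' * vec_u \<eta> s')) \<and>
     (\<forall>s. \<forall>a\<in>act1 G s.
        vec_z \<eta> s \<le> (\<Sum>b\<in>act2 G s. cost1 G s a b * vec_x \<eta> s b)
          + (\<Sum>k=1..num1 G. vec_d1 \<eta> k * dsub1 G k s a)) \<and>
     (\<forall>s'. (\<Sum>s\<in>UNIV. \<Sum>b\<in>act2 G s.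
          (of_bool (s = s') - disc G * pmf (transition G s b) s') * vec_x \<eta> s b)
        = (1 - disc G) * pmf (init G) s') \<and>
     (\<forall>k\<in>{1..num1 G}.
        (\<Sum>s\<in>UNIV. \<Sum>a\<in>act1 G s. dsub1 G k s a * vec_f \<eta> s a) \<le> bound1 G k) \<and>
     (\<forall>l\<in>{1..num2 G}.
        (\<Sum>s\<in>UNIV. \<Sum>a\<in>act1 G s. \<Sum>b\<in>act2 G s.
           vec_f \<eta> s a * dcost2 G l s a b * vec_x \<eta> s b) \<le> bound2 G l) \<and>
     (\<forall>s. (\<Sum>a\<in>act1 G s. vec_f \<eta> s a) = 1) \<and>
     (\<forall>s. \<forall>a\<in>act1 G s. 0 \<le> vec_f \<eta> s a) \<and>
     (\<forall>s. \<forall>b\<in>act2 G s. 0 \<le> vec_x \<eta> s b) \<and>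
     (\<forall>k\<in>{1..num1 G}. 0 \<le> vec_d1 \<eta> k) \<and>
     (\<forall>l\<in>{1..num2 G}. 0 \<le> vec_d2 \<eta> l)"

definition mp_global_min :: "('s::finite, 'a, 'b) game \<Rightarrow> ('s, 'a, 'b) mp_vec \<Rightarrow> bool" where
  "mp_global_min G \<eta> \<longleftrightarrow>
     mp_feasible G \<eta> \<and> (\<forall>\<eta>'. mp_feasible G \<eta>' \<longrightarrow> mp_objective G \<eta> \<le> mp_objective G \<eta>')"

definition has_f_component ::
  "('s::finite, 'a, 'b) game \<Rightarrow> ('s, 'a, 'b) mp_vec \<Rightarrow> ('s \<Rightarrow> 'a pmf) \<Rightarrow> bool" where
  "has_f_component G \<eta> f \<longleftrightarrow> (\<forall>s. \<forall>a\<in>act1 G s. vec_f \<eta> s a = pmf (f s) a)"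

text \<open>
  \<open>g\<close> is the normalisation of the \<open>x\<close>-component; it is unrestricted at states where the
  normalising sum vanishes.
\<close>

definition normalizes_x_component ::
  "('s::finite, 'a, 'b) game \<Rightarrow> ('s, 'a, 'b) mp_vec \<Rightarrow> ('s \<Rightarrow> 'b pmf) \<Rightarrow> bool" where
  "normalizes_x_component G \<eta> g \<longleftrightarrow>
     (\<forall>s. (\<Sum>b\<in>act2 G s. vec_x \<eta> s b) \<noteq> 0 \<longrightarrow>
        (\<forall>b\<in>act2 G s. pmf (g s) b = vec_x \<eta> s b / (\<Sum>b'\<in>act2 G s. vec_x \<eta> s b')))"

end

theory Submission
  imports Defs
begin

text \<open>
  Since only player 2 moves the state, a strategy of player 2 enters every discounted cost only
  through its discounted state-action occupation measure \<open>x\<close>, and each cost is the bilinear form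
  \<open>\<Sum> f c x\<close> in player 1's stationary strategy \<open>f\<close> and this measure. Hence, against a fixed opponent,
  each player's constrained best-response problem is a linear program: player 1 minimises over the
  product of simplices cut by the subscription constraints, player 2 over the nonnegative solutions
  of the flow equations cut by the cost constraints.

  The constraints of the mathematical program are exactly primal and dual feasibility for these two
  linear programs (\<open>mp_feasible_iff\<close>), and its objective is the sum of the two duality gaps
  (\<open>mp_objective_eq\<close>). Weak duality makes it nonnegative, so its value is \<open>0\<close> at a feasible point
  exactly when both gaps vanish. At an equilibrium both primal parts are optimal and strong duality
  supplies multipliers that close the gaps; conversely, a vanishing gap certifies that each part is
  optimal for its program, which is the equilibrium property.

  Two facts translate between strategies and vectors. The occupation measure of any
  history-dependent strategy satisfies the flow equations (\<open>flow_balance_occupation\<close>), so the program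
  of player 2 covers all deviations. Conversely, a solution \<open>x\<close> of the flow equations is the
  occupation measure of the stationary strategy obtained by normalising it, because for a fixed
  stationary strategy the flow equations are a \<open>\<beta>\<close>-contraction on state masses and so have only one
  solution (\<open>flow_balance_unique\<close>, \<open>discounted_stationary\<close>).

  Strong duality is derived from a Farkas lemma proved by Fourier-Motzkin elimination; this is
  purely algebraic, so the number of variables is not tied to the dimension of a type.
\<close>

section \<open>Linear programming duality\<close>

lemma real_between_finite_sets:
  fixes L U :: "real set"
  assumes "finite L" "finite U" "\<And>l u. l \<in> L \<Longrightarrow> u \<in> U \<Longrightarrow> l \<le> u"
  shows "\<exists>t. (\<forall>l\<in>L. l \<le> t) \<and> (\<forall>u\<in>U. t \<le> u)"
proof (cases "L = {}")
  case True
  then show ?thesis using assms(2) by (cases "U = {}") (auto intro!: exI[of _ "Min U"])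
next
  case False
  then have "\<forall>u\<in>U. Max L \<le> u" using assms Max_in[of L] by blast
  then show ?thesis using assms(1) by (intro exI[of _ "Max L"]) simp
qed

text \<open>
  A row \<open>(a, b)\<close> stands for the inequality \<open>b \<le> \<Sum> a\<^sub>j x\<^sub>j\<close>, and \<open>C\<close> is any convex cone of rows, to be
  thought of as the valid consequences of \<open>R\<close>. Eliminating one variable replaces the rows in which
  it occurs by the combinations of a positive and a negative row that cancel it; all of these lie in
  \<open>C\<close>, so once no variable is left the contradiction \<open>0 \<ge> b > 0\<close> is itself a member of \<open>C\<close>. Keeping
  \<open>C\<close> arbitrary lets the induction restrict it to the rows whose eliminated coefficients are \<open>0\<close>,
  without recording how each row was derived.
\<close>

lemma fourier_motzkin_certificate:
  fixes R C :: "(('v \<Rightarrow> real) \<times> real) set"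
  assumes "finite J" "finite R" "R \<subseteq> C"
    and "\<And>r r' s t. r \<in> C \<Longrightarrow> r' \<in> C \<Longrightarrow> 0 \<le> s \<Longrightarrow> 0 \<le> t \<Longrightarrow>
           ((\<lambda>j. s * fst r j + t * fst r' j), s * snd r + t * snd r') \<in> C"
    and "\<nexists>x. \<forall>r\<in>R. snd r \<le> (\<Sum>j\<in>J. fst r j * x j)"
  shows "\<exists>r\<in>C. (\<forall>j\<in>J. fst r j = 0) \<and> 0 < snd r"
  using assms
proof (induction J arbitrary: R C rule: finite_induct)
  case empty
  then show ?case by (force simp: not_le)
next
  case (insert j J)
  define comb where "comb = (\<lambda>(p, n). ((\<lambda>i. (- fst n j) * fst p i + fst p j * fst n i),
      (- fst n j) * snd p + fst p j * (snd n :: real)))"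
  define P where "P = {r\<in>R. 0 < fst r j}"
  define N where "N = {r\<in>R. fst r j < 0}"
  define R' where "R' = {r\<in>R. fst r j = 0} \<union> comb ` (P \<times> N)"
  define C' where "C' = {r\<in>C. fst r j = 0}"
  have fin: "finite P" "finite N" using insert.prems(1) by (auto simp: P_def N_def)
  have "comb (p, n) \<in> C'" if "p \<in> P" "n \<in> N" for p n
  proof -
    have "comb (p, n) \<in> C"
      unfolding comb_def prod.case using that insert.prems(2)
      by (intro insert.prems(3)) (auto simp: P_def N_def)
    then show ?thesis by (simp add: C'_def comb_def)
  qed
  then have R'C': "R' \<subseteq> C'"
    using insert.prems(2) by (auto simp: R'_def C'_def)
  have "\<nexists>x. \<forall>r\<in>R'. snd r \<le> (\<Sum>i\<in>J. fst r i * x i)"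
  proof
    assume "\<exists>x. \<forall>r\<in>R'. snd r \<le> (\<Sum>i\<in>J. fst r i * x i)"
    then obtain x where x: "\<And>r. r \<in> R' \<Longrightarrow> snd r \<le> (\<Sum>i\<in>J. fst r i * x i)" by blast
    (* A row with nonzero coefficient at j bounds the value of x j by q r: from below on P and from
       above on N. *)
    define S where "S r = (\<Sum>i\<in>J. fst r i * x i)" for r :: "('v \<Rightarrow> real) \<times> real"
    define q where "q r = (snd r - S r) / fst r j" for r
    have "q p \<le> q n" if "p \<in> P" "n \<in> N" for p n
    proof -
      have "comb (p, n) \<in> R'" using that by (auto simp: R'_def)
      from x[OF this]
      have "(- fst n j) * snd p + fst p j * snd n \<le> (- fst n j) * S p + fst p j * S n"
        by (simp add: comb_def S_def sum.distrib sum_distrib_left algebra_simps sum_subtractf sum_negf)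
      then show ?thesis using that unfolding q_def P_def N_def
        by (simp add: divide_simps algebra_simps)
    qed
    then have "\<exists>t. (\<forall>l\<in>q ` P. l \<le> t) \<and> (\<forall>u\<in>q ` N. t \<le> u)"
      using fin by (intro real_between_finite_sets) blast+
    then obtain t where t: "\<And>p. p \<in> P \<Longrightarrow> q p \<le> t" "\<And>n. n \<in> N \<Longrightarrow> t \<le> q n"
      by blast
    have "snd r \<le> (\<Sum>i\<in>insert j J. fst r i * (x(j := t)) i)" if "r \<in> R" for r
    proof -
      have eq: "(\<Sum>i\<in>insert j J. fst r i * (x(j := t)) i) = fst r j * t + S r"
        using insert.hyps by (simp add: S_def) (rule sum.cong, auto)
      consider "fst r j = 0" | "r \<in> P" | "r \<in> N" using \<open>r \<in> R\<close> by (force simp: P_def N_def)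
      then have "snd r \<le> fst r j * t + S r"
      proof cases
        case 1
        then show ?thesis using x[of r] \<open>r \<in> R\<close> by (simp add: R'_def S_def)
      next
        case 2
        then show ?thesis using t(1)[OF 2]
          by (simp add: q_def P_def divide_simps algebra_simps)
      next
        case 3
        then show ?thesis using t(2)[OF 3]
          by (simp add: q_def N_def divide_simps algebra_simps)
      qed
      with eq show ?thesis by simp
    qed
    with insert.prems(4) show False by blast
  qed
  moreover have "finite R'" using fin insert.prems(1) by (simp add: R'_def)
  moreover have "((\<lambda>i. s * fst r i + t * fst r' i), s * snd r + t * snd r') \<in> C'"
    if "r \<in> C'" "r' \<in> C'" "0 \<le> s" "0 \<le> t" for r r' s t
    using that insert.prems(3)[of r r' s t] by (simp add: C'_def)
  ultimately have "\<exists>r\<in>C'. (\<forall>i\<in>J. fst r i = 0) \<and> 0 < snd r"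
    using R'C' by (intro insert.IH) auto
  then show ?case unfolding C'_def ball_simps by blast
qed

text \<open>
  The indexed form, with \<open>C\<close> instantiated to the nonnegative combinations of the given rows, so that
  the certificate comes with its multipliers.
\<close>

lemma farkas:
  fixes A :: "'i \<Rightarrow> 'v \<Rightarrow> real" and b :: "'i \<Rightarrow> real"
  assumes "finite J" "finite I"
    and infeasible: "\<nexists>x. \<forall>i\<in>I. b i \<le> (\<Sum>j\<in>J. A i j * x j)"
  shows "\<exists>y. (\<forall>i\<in>I. 0 \<le> y i) \<and> (\<forall>j\<in>J. (\<Sum>i\<in>I. y i * A i j) = 0) \<and> 0 < (\<Sum>i\<in>I. y i * b i)"
proof -
  define R where "R = (\<lambda>i. (A i, b i)) ` I"
  define C where "C = {((\<lambda>j. \<Sum>i\<in>I. y i * A i j), (\<Sum>i\<in>I. y i * b i)) | y. \<forall>i\<in>I. 0 \<le> y i}"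
  have "(A i, b i) \<in> C" if "i \<in> I" for i
    unfolding C_def using that assms(2)
    by (intro CollectI exI[of _ "\<lambda>k. of_bool (k = i)"]) simp
  then have "R \<subseteq> C" by (auto simp: R_def)
  moreover have "((\<lambda>j. s * fst r j + t * fst r' j), s * snd r + t * snd r') \<in> C"
    if rC: "r \<in> C" "r' \<in> C" and st: "0 \<le> s" "0 \<le> t" for r r' s t
  proof -
    obtain y where y: "r = ((\<lambda>j. \<Sum>i\<in>I. y i * A i j), (\<Sum>i\<in>I. y i * b i))" "\<forall>i\<in>I. 0 \<le> y i"
      using rC(1) unfolding C_def by blast
    obtain y' where y': "r' = ((\<lambda>j. \<Sum>i\<in>I. y' i * A i j), (\<Sum>i\<in>I. y' i * b i))" "\<forall>i\<in>I. 0 \<le> y' i"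
      using rC(2) unfolding C_def by blast
    show ?thesis unfolding C_def using y y' st
      by (intro CollectI exI[of _ "\<lambda>i. s * y i + t * y' i"])
        (simp add: sum_distrib_left sum.distrib algebra_simps)
  qed
  moreover have "finite R" using assms(2) by (simp add: R_def)
  moreover have "\<nexists>x. \<forall>r\<in>R. snd r \<le> (\<Sum>j\<in>J. fst r j * x j)"
    using infeasible by (simp add: R_def)
  ultimately have "\<exists>r\<in>C. (\<forall>j\<in>J. fst r j = 0) \<and> 0 < snd r"
    using assms(1) by (intro fourier_motzkin_certificate)
  then show ?thesis by (auto simp: C_def)
qed

text \<open>
  The linear program of minimising \<open>c x\<close> subject to \<open>A x = b\<close>, \<open>B x \<le> d\<close>, \<open>x \<ge> 0\<close>. In the dual the
  equality multipliers \<open>u\<close> are free, the inequality multipliers \<open>w\<close> are nonnegative, and \<open>u b - w d\<close>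
  is maximised.
\<close>

definition lp_primal ::
  "'j set \<Rightarrow> 'e set \<Rightarrow> 'i set \<Rightarrow> ('e \<Rightarrow> 'j \<Rightarrow> real) \<Rightarrow> ('e \<Rightarrow> real) \<Rightarrow>
     ('i \<Rightarrow> 'j \<Rightarrow> real) \<Rightarrow> ('i \<Rightarrow> real) \<Rightarrow> ('j \<Rightarrow> real) \<Rightarrow> bool" where
  "lp_primal J E I A b B d x \<longleftrightarrow>
     (\<forall>j\<in>J. 0 \<le> x j) \<and> (\<forall>e\<in>E. (\<Sum>j\<in>J. A e j * x j) = b e) \<and>
     (\<forall>i\<in>I. (\<Sum>j\<in>J. B i j * x j) \<le> d i)"

definition lp_dual ::
  "'j set \<Rightarrow> 'e set \<Rightarrow> 'i set \<Rightarrow> ('e \<Rightarrow> 'j \<Rightarrow> real) \<Rightarrow>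
     ('i \<Rightarrow> 'j \<Rightarrow> real) \<Rightarrow> ('j \<Rightarrow> real) \<Rightarrow> ('e \<Rightarrow> real) \<Rightarrow> ('i \<Rightarrow> real) \<Rightarrow> bool" where
  "lp_dual J E I A B c u w \<longleftrightarrow>
     (\<forall>i\<in>I. 0 \<le> w i) \<and>
     (\<forall>j\<in>J. (\<Sum>e\<in>E. u e * A e j) \<le> c j + (\<Sum>i\<in>I. w i * B i j))"

lemma lp_weak_duality:
  assumes "lp_primal J E I A b B d x" "lp_dual J E I A B c u w"
  shows "(\<Sum>e\<in>E. u e * b e) - (\<Sum>i\<in>I. w i * d i) \<le> (\<Sum>j\<in>J. c j * x j)"
proof -
  have "(\<Sum>e\<in>E. u e * b e) = (\<Sum>e\<in>E. \<Sum>j\<in>J. u e * A e j * x j)"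
    using assms(1)
    by (intro sum.cong) (auto simp: lp_primal_def mult.assoc simp flip: sum_distrib_left)
  also have "\<dots> = (\<Sum>j\<in>J. (\<Sum>e\<in>E. u e * A e j) * x j)"
    by (subst sum.swap) (simp add: sum_distrib_right)
  also have "\<dots> \<le> (\<Sum>j\<in>J. (c j + (\<Sum>i\<in>I. w i * B i j)) * x j)"
    using assms by (intro sum_mono mult_right_mono) (auto simp: lp_primal_def lp_dual_def)
  also have "\<dots> = (\<Sum>j\<in>J. c j * x j) + (\<Sum>j\<in>J. \<Sum>i\<in>I. w i * B i j * x j)"
    by (simp add: distrib_right sum.distrib sum_distrib_right)
  also have "(\<Sum>j\<in>J. \<Sum>i\<in>I. w i * B i j * x j) = (\<Sum>i\<in>I. w i * (\<Sum>j\<in>J. B i j * x j))"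
    by (subst sum.swap) (simp add: sum_distrib_left mult.assoc)
  also have "\<dots> \<le> (\<Sum>i\<in>I. w i * d i)"
    using assms by (intro sum_mono mult_left_mono) (auto simp: lp_primal_def lp_dual_def)
  finally show ?thesis by simp
qed

text \<open>
  If no dual point reaches the value \<open>v\<close> of the optimal \<open>x\<close>, Farkas' lemma gives \<open>h \<ge> 0\<close> and
  \<open>t \<ge> 0\<close> with \<open>A h = t b\<close>, \<open>B h \<le> t d\<close> and \<open>c h < t v\<close>. Then \<open>(x + h) / (1 + t)\<close> is feasible and
  cheaper than \<open>x\<close>. Averaging with \<open>x\<close> treats a better point (\<open>t > 0\<close>) and an improving recession
  direction (\<open>t = 0\<close>) at once.
\<close>

lemma lp_strong_duality:
  fixes c :: "'j \<Rightarrow> real" and A :: "'e \<Rightarrow> 'j \<Rightarrow> real" and B :: "'i \<Rightarrow> 'j \<Rightarrow> real"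
  assumes fin: "finite J" "finite E" "finite I"
    and x: "lp_primal J E I A b B d x"
    and opt: "\<And>x'. lp_primal J E I A b B d x' \<Longrightarrow> (\<Sum>j\<in>J. c j * x j) \<le> (\<Sum>j\<in>J. c j * x' j)"
  shows "\<exists>u w. lp_dual J E I A B c u w \<and>
           (\<Sum>e\<in>E. u e * b e) - (\<Sum>i\<in>I. w i * d i) = (\<Sum>j\<in>J. c j * x j)"
proof (rule ccontr)
  assume none: "\<not> ?thesis"
  define v where "v = (\<Sum>j\<in>J. c j * x j)"
  (* Variables: u on the left, w on the right. Rows: one dual constraint for each j, w i >= 0 for
     each i, and finally the demand that the dual value be at least v. *)
  define row :: "('j + 'i) + unit \<Rightarrow> 'e + 'i \<Rightarrow> real" where
    "row = case_sum (case_sum (\<lambda>j. case_sum (\<lambda>e. - A e j) (\<lambda>i. B i j))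
                              (\<lambda>i. case_sum (\<lambda>_. 0) (\<lambda>i'. of_bool (i' = i))))
                    (\<lambda>_. case_sum b (\<lambda>i. - d i))"
  define rhs :: "('j + 'i) + unit \<Rightarrow> real" where
    "rhs = case_sum (case_sum (\<lambda>j. - c j) (\<lambda>_. 0)) (\<lambda>_. v)"
  have "\<nexists>m. \<forall>r\<in>(J <+> I) <+> UNIV. rhs r \<le> (\<Sum>k\<in>E <+> I. row r k * m k)"
  proof
    assume "\<exists>m. \<forall>r\<in>(J <+> I) <+> UNIV. rhs r \<le> (\<Sum>k\<in>E <+> I. row r k * m k)"
    then obtain m where m: "\<forall>r\<in>(J <+> I) <+> UNIV. rhs r \<le> (\<Sum>k\<in>E <+> I. row r k * m k)"
      by blast
    define u where "u = m \<circ> Inl"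
    define w where "w = m \<circ> Inr"
    have r: "rhs r \<le> (\<Sum>e\<in>E. row r (Inl e) * u e) + (\<Sum>i\<in>I. row r (Inr i) * w i)"
      if "r \<in> (J <+> I) <+> UNIV" for r
      using m that fin by (simp add: sum.Plus u_def w_def)
    have "0 \<le> w i" if "i \<in> I" for i
      using r[OF InlI[OF InrI[OF that]]] that fin by (simp add: row_def rhs_def)
    moreover have "(\<Sum>e\<in>E. u e * A e j) \<le> c j + (\<Sum>i\<in>I. w i * B i j)" if "j \<in> J" for j
      using r[OF InlI[OF InlI[OF that]]] by (simp add: row_def rhs_def sum_negf mult.commute)
    ultimately have dual: "lp_dual J E I A B c u w" by (simp add: lp_dual_def)
    moreover have "v \<le> (\<Sum>e\<in>E. u e * b e) - (\<Sum>i\<in>I. w i * d i)"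
      using r[OF InrI[OF UNIV_I]] by (simp add: row_def rhs_def sum_negf mult.commute)
    ultimately show False
      using none lp_weak_duality[OF x dual] by (auto simp: v_def)
  qed
  then obtain y where y: "\<forall>r\<in>(J <+> I) <+> UNIV. 0 \<le> y r"
      "\<forall>k\<in>E <+> I. (\<Sum>r\<in>(J <+> I) <+> UNIV. y r * row r k) = 0"
      "0 < (\<Sum>r\<in>(J <+> I) <+> UNIV. y r * rhs r)"
    using farkas[of "E <+> I" "(J <+> I) <+> UNIV" rhs row] fin by auto
  define t where "t = y (Inr ())"
  define h where "h j = y (Inl (Inl j))" for j
  define sl where "sl i = y (Inl (Inr i))" for i
  have split: "(\<Sum>r\<in>(J <+> I) <+> UNIV. y r * F r) =
      (\<Sum>j\<in>J. h j * F (Inl (Inl j))) + (\<Sum>i\<in>I. sl i * F (Inl (Inr i))) + t * F (Inr ())"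
    for F :: "('j + 'i) + unit \<Rightarrow> real"
    using fin by (simp add: sum.Plus t_def h_def sl_def UNIV_unit)
  have t0: "0 \<le> t" and h0: "\<And>j. j \<in> J \<Longrightarrow> 0 \<le> h j" and sl0: "\<And>i. i \<in> I \<Longrightarrow> 0 \<le> sl i"
    using y(1) by (auto simp: t_def h_def sl_def)
  have eqE: "(\<Sum>j\<in>J. A e j * h j) = t * b e" if "e \<in> E" for e
    using y(2)[rule_format, OF InlI[OF that]] unfolding split
    by (simp add: row_def sum_negf mult.commute)
  have leI: "(\<Sum>j\<in>J. B i j * h j) \<le> t * d i" if "i \<in> I" for i
    using y(2)[rule_format, OF InrI[OF that]] that sl0[OF that] fin unfolding split
    by (simp add: row_def mult.commute)
  have better: "(\<Sum>j\<in>J. c j * h j) < t * v"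
    using y(3) unfolding split by (simp add: rhs_def sum_negf mult.commute)
  define x' where "x' j = (x j + h j) / (1 + t)" for j
  have lin: "(\<Sum>j\<in>J. F j * x' j) = ((\<Sum>j\<in>J. F j * x j) + (\<Sum>j\<in>J. F j * h j)) / (1 + t)"
    for F :: "'j \<Rightarrow> real"
    by (simp add: x'_def sum_divide_distrib[symmetric] sum.distrib distrib_left)
  have "lp_primal J E I A b B d x'"
    unfolding lp_primal_def lin
  proof (intro conjI ballI)
    show "0 \<le> x' j" if "j \<in> J" for j
      using x h0[OF that] t0 that by (simp add: x'_def lp_primal_def)
    show "((\<Sum>j\<in>J. A e j * x j) + (\<Sum>j\<in>J. A e j * h j)) / (1 + t) = b e" if "e \<in> E" for e
      using x eqE[OF that] t0 that by (simp add: lp_primal_def field_simps)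
    show "((\<Sum>j\<in>J. B i j * x j) + (\<Sum>j\<in>J. B i j * h j)) / (1 + t) \<le> d i" if "i \<in> I" for i
    proof -
      have "(\<Sum>j\<in>J. B i j * x j) \<le> d i" using x that by (simp add: lp_primal_def)
      then show ?thesis using leI[OF that] t0 by (simp add: field_simps)
    qed
  qed
  from opt[OF this] have "v \<le> (v + (\<Sum>j\<in>J. c j * h j)) / (1 + t)"
    unfolding lin by (simp add: v_def)
  with better t0 show False by (simp add: field_simps)
qed

section \<open>Discounted occupation measures\<close>

definition total_cost ::
  "('s::finite, 'a, 'b) game \<Rightarrow> ('s \<Rightarrow> 'a \<Rightarrow> 'b \<Rightarrow> real) \<Rightarrow> ('s \<Rightarrow> 'a \<Rightarrow> real) \<Rightarrow>
     ('s \<Rightarrow> 'b \<Rightarrow> real) \<Rightarrow> real" where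
  "total_cost G c f x = (\<Sum>s\<in>UNIV. \<Sum>a\<in>act1 G s. \<Sum>b\<in>act2 G s. f s a * c s a b * x s b)"

definition flow_balance :: "('s::finite, 'a, 'b) game \<Rightarrow> ('s \<Rightarrow> 'b \<Rightarrow> real) \<Rightarrow> bool" where
  "flow_balance G x \<longleftrightarrow>
     (\<forall>s'. (\<Sum>s\<in>UNIV. \<Sum>b\<in>act2 G s.
          (of_bool (s = s') - disc G * pmf (transition G s b) s') * x s b)
        = (1 - disc G) * pmf (init G) s')"

text \<open>
  The flow equations in recursive form: the mass of a state is its initial mass plus the discounted
  mass flowing into it. Both the occupation measure and the uniqueness argument use this form.
\<close>

lemma flow_balance_iff:
  "flow_balance G x \<longleftrightarrow>
     (\<forall>s'. (\<Sum>b\<in>act2 G s'. x s' b) =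
        (1 - disc G) * pmf (init G) s' +
        disc G * (\<Sum>s\<in>UNIV. \<Sum>b\<in>act2 G s. pmf (transition G s b) s' * x s b))"
proof -
  have eq: "(\<Sum>s\<in>UNIV. \<Sum>b\<in>act2 G s. (of_bool (s = s') - disc G * pmf (transition G s b) s') * x s b)
      = (\<Sum>b\<in>act2 G s'. x s' b) -
        disc G * (\<Sum>s\<in>UNIV. \<Sum>b\<in>act2 G s. pmf (transition G s b) s' * x s b)" for s'
  proof -
    have "(\<Sum>s\<in>UNIV. \<Sum>b\<in>act2 G s. of_bool (s = s') * x s b) = (\<Sum>b\<in>act2 G s'. x s' b)"
      by (simp flip: sum_distrib_left)
    then show ?thesis
      by (simp add: left_diff_distrib sum_subtractf sum_distrib_left mult.assoc)
  qed
  show ?thesis unfolding flow_balance_def eq diff_eq_eq ..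
qed

definition state_law ::
  "('s::finite, 'a, 'b) game \<Rightarrow> ('s \<Rightarrow> 'a pmf) \<Rightarrow> (('s, 'a, 'b) past \<Rightarrow> 's \<Rightarrow> 'b pmf) \<Rightarrow>
     nat \<Rightarrow> 's pmf" where
  "state_law G f gh t = map_pmf snd (history_law G f gh t)"

definition state_action_law ::
  "('s::finite, 'a, 'b) game \<Rightarrow> ('s \<Rightarrow> 'a pmf) \<Rightarrow> (('s, 'a, 'b) past \<Rightarrow> 's \<Rightarrow> 'b pmf) \<Rightarrow>
     nat \<Rightarrow> ('s \<times> 'b) pmf" where
  "state_action_law G f gh t =
     bind_pmf (history_law G f gh t) (\<lambda>(h, s). map_pmf (Pair s) (gh h s))"

definition occupation ::
  "('s::finite, 'a, 'b) game \<Rightarrow> ('s \<Rightarrow> 'a pmf) \<Rightarrow> (('s, 'a, 'b) past \<Rightarrow> 's \<Rightarrow> 'b pmf) \<Rightarrow>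
     's \<Rightarrow> 'b \<Rightarrow> real" where
  "occupation G f gh s b =
     (1 - disc G) * (\<Sum>t. disc G ^ t * pmf (state_action_law G f gh t) (s, b))"

text \<open>
  A behavioral strategy is only known to choose admissible actions after admissible pasts, so the
  support of the history law has to be controlled before that of the actions.
\<close>

lemma history_law_admissible:
  assumes "f \<in> stationary1 G" "gh \<in> behavioral2 G" "(h, s) \<in> set_pmf (history_law G f gh t)"
  shows "set h \<subseteq> admissible G"
  using assms(3)
proof (induction t arbitrary: h s)
  case 0
  then show ?case by auto
next
  case (Suc t)
  then obtain h' s0 a b where h: "(h', s0) \<in> set_pmf (history_law G f gh t)" "a \<in> set_pmf (f s0)"
      "b \<in> set_pmf (gh h' s0)" "h = h' @ [(s0, a, b)]"
    by auto
  moreover have "set h' \<subseteq> admissible G" using Suc.IH[OF h(1)] .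
  ultimately show ?case using assms(1,2)
    unfolding stationary1_def behavioral2_def by (fastforce simp: admissible_def)
qed

lemma state_action_law_support:
  assumes "f \<in> stationary1 G" "gh \<in> behavioral2 G"
  shows "set_pmf (state_action_law G f gh t) \<subseteq> (SIGMA s:UNIV. act2 G s)"
  using history_law_admissible[OF assms] assms(2)
  unfolding state_action_law_def behavioral2_def by fastforce

lemma map_fst_state_action_law: "map_pmf fst (state_action_law G f gh t) = state_law G f gh t"
  by (simp add: state_action_law_def state_law_def map_bind_pmf map_pmf_comp case_prod_beta)
     (simp add: map_pmf_def)

lemma state_law_0: "state_law G f gh 0 = init G"
  by (simp add: state_law_def map_pmf_comp)

lemma state_law_Suc:
  "state_law G f gh (Suc t) = bind_pmf (state_action_law G f gh t) (\<lambda>(s, b). transition G s b)"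
  by (simp add: state_law_def state_action_law_def map_bind_pmf map_pmf_comp case_prod_beta
      bind_assoc_pmf bind_map_pmf)

lemma triple_law_eq:
  "triple_law G f gh t =
     bind_pmf (state_action_law G f gh t) (\<lambda>(s, b). map_pmf (\<lambda>a. (s, a, b)) (f s))"
proof -
  have "map_pmf (\<lambda>(a, b). (s, a, b)) (pair_pmf (f s) q) =
      bind_pmf q (\<lambda>b. map_pmf (\<lambda>a. (s, a, b)) (f s))" for s q
    by (simp add: pair_pmf_def map_bind_pmf bind_commute_pmf[of "f s"] map_pmf_def
        bind_assoc_pmf bind_return_pmf)
  then show ?thesis
    unfolding triple_law_def state_action_law_def bind_assoc_pmf
    by (intro bind_pmf_cong refl) (auto simp: bind_map_pmf)
qed

text \<open>
  Player 1 uses a stationary strategy, so given the current state his action is independent of the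
  past and hence of player 2's action. This is what makes expected costs bilinear.
\<close>

lemma pmf_triple_law:
  "pmf (triple_law G f gh t) (s, a, b) = pmf (f s) a * pmf (state_action_law G f gh t) (s, b)"
proof -
  have "pmf (map_pmf (\<lambda>a. (s', a, b')) (f s')) (s, a, b) =
      pmf (f s) a * indicator {(s, b)} (s', b')" for s' b'
  proof (cases "(s', b') = (s, b)")
    case True
    have "inj (\<lambda>a. (s, a, b))" by (auto intro: injI)
    from pmf_map_inj'[OF this, of "f s" a] True show ?thesis by simp
  next
    case False
    then show ?thesis by (auto simp: pmf_eq_0_set_pmf)
  qed
  then show ?thesis
    by (simp add: triple_law_eq pmf_bind case_prod_beta measure_pmf_single)
qed

lemma expectation_triple_law:
  assumes "valid_game G" "f \<in> stationary1 G" "gh \<in> behavioral2 G"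
  shows "measure_pmf.expectation (triple_law G f gh t) (\<lambda>(s, a, b). c s a b) =
    total_cost G c (\<lambda>s. pmf (f s)) (\<lambda>s b. pmf (state_action_law G f gh t) (s, b))"
proof -
  let ?A = "SIGMA s:UNIV. act1 G s \<times> act2 G s"
  have fin: "finite (act1 G s)" "finite (act2 G s)" for s
    using assms(1) by (auto simp: valid_game_def)
  have "set_pmf (triple_law G f gh t) \<subseteq> ?A"
    using state_action_law_support[OF assms(2,3), of t] assms(2)
    by (fastforce simp: triple_law_eq stationary1_def)
  then have "measure_pmf.expectation (triple_law G f gh t) (\<lambda>(s, a, b). c s a b) =
      (\<Sum>r\<in>?A. (case r of (s, a, b) \<Rightarrow> c s a b) * pmf (triple_law G f gh t) r)"
    using fin by (intro integral_measure_pmf_real) auto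
  also have "\<dots> = (\<Sum>s\<in>UNIV. \<Sum>(a, b)\<in>act1 G s \<times> act2 G s.
      pmf (f s) a * c s a b * pmf (state_action_law G f gh t) (s, b))"
    using fin by (subst sum.Sigma) (auto simp: pmf_triple_law intro!: sum.cong)
  also have "\<dots> = total_cost G c (\<lambda>s. pmf (f s)) (\<lambda>s b. pmf (state_action_law G f gh t) (s, b))"
    by (simp add: total_cost_def sum.cartesian_product)
  finally show ?thesis .
qed

lemma pmf_state_law_eq_sum:
  assumes "valid_game G" "f \<in> stationary1 G" "gh \<in> behavioral2 G"
  shows "pmf (state_law G f gh t) s = (\<Sum>b\<in>act2 G s. pmf (state_action_law G f gh t) (s, b))"
proof -
  let ?q = "state_action_law G f gh t"
  have fin: "finite (act2 G s)" using assms(1) by (auto simp: valid_game_def)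
  have "pmf (state_law G f gh t) s = measure ?q (fst -` {s})"
    by (simp add: map_fst_state_action_law[symmetric] pmf_map)
  also have "\<dots> = measure ?q (Pair s ` act2 G s)"
    using state_action_law_support[OF assms(2,3), of t]
    by (intro measure_eq_AE) (auto simp: AE_measure_pmf_iff)
  also have "\<dots> = (\<Sum>b\<in>act2 G s. pmf ?q (s, b))"
    using fin by (simp add: measure_measure_pmf_finite sum.reindex inj_on_def)
  finally show ?thesis .
qed

lemma pmf_state_law_Suc:
  assumes "valid_game G" "f \<in> stationary1 G" "gh \<in> behavioral2 G"
  shows "pmf (state_law G f gh (Suc t)) s' =
    (\<Sum>s\<in>UNIV. \<Sum>b\<in>act2 G s. pmf (transition G s b) s' * pmf (state_action_law G f gh t) (s, b))"
proof -
  have fin: "finite (act2 G s)" for s using assms(1) by (auto simp: valid_game_def)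
  have "pmf (state_law G f gh (Suc t)) s' = measure_pmf.expectation (state_action_law G f gh t)
      (\<lambda>r. pmf (case r of (s, b) \<Rightarrow> transition G s b) s')"
    by (simp add: state_law_Suc pmf_bind)
  also have "\<dots> = (\<Sum>r\<in>(SIGMA s:UNIV. act2 G s).
      pmf (case r of (s, b) \<Rightarrow> transition G s b) s' * pmf (state_action_law G f gh t) r)"
    using fin state_action_law_support[OF assms(2,3), of t]
    by (intro integral_measure_pmf_real) auto
  also have "\<dots> = (\<Sum>s\<in>UNIV. \<Sum>b\<in>act2 G s.
      pmf (transition G s b) s' * pmf (state_action_law G f gh t) (s, b))"
    using fin by (subst sum.Sigma) (auto intro!: sum.cong)
  finally show ?thesis .
qed

lemma summable_discounted_pmf:
  assumes "valid_game G"
  shows "summable (\<lambda>t. disc G ^ t * pmf (q t) r)"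
  using assms
  by (intro summable_comparison_test'[OF summable_geometric[of "disc G"]])
     (auto simp: valid_game_def abs_mult pmf_le_1 mult_left_le)

lemma sums_occupation:
  assumes "valid_game G"
  shows "(\<lambda>t. (1 - disc G) * (disc G ^ t * pmf (state_action_law G f gh t) (s, b)))
    sums occupation G f gh s b"
  unfolding occupation_def by (intro sums_mult summable_sums summable_discounted_pmf assms)

lemma occupation_nonneg:
  assumes "valid_game G"
  shows "0 \<le> occupation G f gh s b"
  using assms summable_discounted_pmf[OF assms]
  by (auto simp: occupation_def valid_game_def intro!: mult_nonneg_nonneg suminf_nonneg)

lemma discounted_eq_total_cost:
  assumes "valid_game G" "f \<in> stationary1 G" "gh \<in> behavioral2 G"
  shows "discounted G c f gh = total_cost G c (\<lambda>s. pmf (f s)) (occupation G f gh)"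
proof -
  have "(\<lambda>t. \<Sum>s\<in>UNIV. \<Sum>a\<in>act1 G s. \<Sum>b\<in>act2 G s. pmf (f s) a * c s a b *
      (disc G ^ t * pmf (state_action_law G f gh t) (s, b)))
    sums (\<Sum>s\<in>UNIV. \<Sum>a\<in>act1 G s. \<Sum>b\<in>act2 G s. pmf (f s) a * c s a b *
      (\<Sum>t. disc G ^ t * pmf (state_action_law G f gh t) (s, b)))"
    by (intro sums_sum sums_mult summable_sums summable_discounted_pmf assms)
  then have "(\<Sum>t. disc G ^ t *
      measure_pmf.expectation (triple_law G f gh t) (\<lambda>(s, a, b). c s a b)) =
      (\<Sum>s\<in>UNIV. \<Sum>a\<in>act1 G s. \<Sum>b\<in>act2 G s. pmf (f s) a * c s a b *
      (\<Sum>t. disc G ^ t * pmf (state_action_law G f gh t) (s, b)))"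
    by (intro sums_unique[symmetric])
       (simp add: expectation_triple_law[OF assms] total_cost_def sum_distrib_left mult_ac)
  then show ?thesis
    by (simp add: discounted_def total_cost_def occupation_def sum_distrib_left mult_ac)
qed

text \<open>
  The state law at time \<open>t + 1\<close> is the image of the state-action law at time \<open>t\<close> under the transitions,
  so the discounted series of state masses, with its first term split off, is the flow equation.
\<close>

lemma flow_balance_occupation:
  assumes "valid_game G" "f \<in> stationary1 G" "gh \<in> behavioral2 G"
  shows "flow_balance G (occupation G f gh)"
  unfolding flow_balance_iff
proof
  fix s'
  let ?\<beta> = "disc G" and ?\<mu> = "\<lambda>t. pmf (state_law G f gh t) s'"
  have sm: "(\<lambda>t. (1 - ?\<beta>) * (?\<beta> ^ t * ?\<mu> t)) sums (\<Sum>b\<in>act2 G s'. occupation G f gh s' b)"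
    unfolding pmf_state_law_eq_sum[OF assms] sum_distrib_left
    by (intro sums_sum sums_occupation assms)
  have "(\<lambda>t. ?\<beta> * (\<Sum>s\<in>UNIV. \<Sum>b\<in>act2 G s. pmf (transition G s b) s' *
      ((1 - ?\<beta>) * (?\<beta> ^ t * pmf (state_action_law G f gh t) (s, b)))))
    sums (?\<beta> * (\<Sum>s\<in>UNIV. \<Sum>b\<in>act2 G s. pmf (transition G s b) s' * occupation G f gh s b))"
    by (intro sums_mult sums_sum sums_occupation assms)
  moreover have "?\<beta> * (\<Sum>s\<in>UNIV. \<Sum>b\<in>act2 G s. pmf (transition G s b) s' *
      ((1 - ?\<beta>) * (?\<beta> ^ t * pmf (state_action_law G f gh t) (s, b)))) =
      (1 - ?\<beta>) * (?\<beta> ^ Suc t * ?\<mu> (Suc t))" for t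
    by (simp add: pmf_state_law_Suc[OF assms] sum_distrib_left mult_ac)
  ultimately have "(\<lambda>t. (1 - ?\<beta>) * (?\<beta> ^ Suc t * ?\<mu> (Suc t)))
      sums (?\<beta> * (\<Sum>s\<in>UNIV. \<Sum>b\<in>act2 G s. pmf (transition G s b) s' * occupation G f gh s b))"
    by simp
  from sums_unique2[OF sm sums_Suc[OF this]]
  show "(\<Sum>b\<in>act2 G s'. occupation G f gh s' b) = (1 - ?\<beta>) * pmf (init G) s' +
      ?\<beta> * (\<Sum>s\<in>UNIV. \<Sum>b\<in>act2 G s. pmf (transition G s b) s' * occupation G f gh s b)"
    by (simp add: state_law_0 add.commute)
qed

text \<open>
  If \<open>P\<close> is the transition matrix induced by \<open>g\<close>, the difference \<open>D\<close> of the two state masses satisfies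
  \<open>D = \<beta> D P\<close>. As \<open>P\<close> is stochastic, the \<open>\<ell>\<^sup>1\<close>-norm of \<open>D\<close> is at most \<open>\<beta>\<close> times itself, so \<open>D = 0\<close>.
\<close>

lemma flow_balance_unique:
  assumes "valid_game G" "g \<in> stationary2 G" "flow_balance G x" "flow_balance G y"
    and x: "\<And>s b. b \<in> act2 G s \<Longrightarrow> x s b = X s * pmf (g s) b"
    and y: "\<And>s b. b \<in> act2 G s \<Longrightarrow> y s b = Y s * pmf (g s) b"
  shows "X s = Y s"
proof -
  let ?\<beta> = "disc G"
  define P where "P s s' = (\<Sum>b\<in>act2 G s. pmf (g s) b * pmf (transition G s b) s')" for s s'
  define D where "D s = X s - Y s" for s
  have \<beta>: "0 \<le> ?\<beta>" "?\<beta> < 1" and fin: "finite (act2 G s)" for s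
    using assms(1) by (auto simp: valid_game_def)
  have g1: "(\<Sum>b\<in>act2 G s. pmf (g s) b) = 1" for s
    using assms(2) fin by (intro sum_pmf_eq_1) (auto simp: stationary2_def)
  have tr: "(\<Sum>s'\<in>UNIV. pmf (transition G s b) s') = 1" for s b
    by (intro sum_pmf_eq_1) auto
  have Z: "Z s' = (1 - ?\<beta>) * pmf (init G) s' + ?\<beta> * (\<Sum>s\<in>UNIV. Z s * P s s')"
    if "flow_balance G z" "\<And>s b. b \<in> act2 G s \<Longrightarrow> z s b = Z s * pmf (g s) b" for z Z s'
  proof -
    have "Z s' = (\<Sum>b\<in>act2 G s'. z s' b)"
      by (simp add: that(2) g1 flip: sum_distrib_left)
    moreover have "(\<Sum>s\<in>UNIV. \<Sum>b\<in>act2 G s. pmf (transition G s b) s' * z s b) =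
        (\<Sum>s\<in>UNIV. Z s * P s s')"
      by (simp add: that(2) P_def sum_distrib_left mult_ac)
    ultimately show ?thesis using that(1) by (simp add: flow_balance_iff)
  qed
  have D: "D s' = ?\<beta> * (\<Sum>s\<in>UNIV. D s * P s s')" for s'
    using Z[OF assms(3) x, of s'] Z[OF assms(4) y, of s']
    by (simp add: D_def left_diff_distrib sum_subtractf algebra_simps)
  have P0: "0 \<le> P s s'" for s s' by (simp add: P_def sum_nonneg)
  have P1: "(\<Sum>s'\<in>UNIV. P s s') = 1" for s
    unfolding P_def by (subst sum.swap) (simp add: tr g1 flip: sum_distrib_left)
  have "(\<Sum>s'\<in>UNIV. \<bar>D s'\<bar>) \<le> (\<Sum>s'\<in>UNIV. ?\<beta> * (\<Sum>s\<in>UNIV. \<bar>D s\<bar> * P s s'))"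
  proof (rule sum_mono)
    fix s'
    have "\<bar>D s'\<bar> = ?\<beta> * \<bar>\<Sum>s\<in>UNIV. D s * P s s'\<bar>"
      by (subst D) (simp add: abs_mult \<beta>)
    also have "\<dots> \<le> ?\<beta> * (\<Sum>s\<in>UNIV. \<bar>D s\<bar> * P s s')"
      using sum_abs[of "\<lambda>s. D s * P s s'" UNIV] P0 \<beta>
      by (intro mult_left_mono) (simp_all add: abs_mult)
    finally show "\<bar>D s'\<bar> \<le> ?\<beta> * (\<Sum>s\<in>UNIV. \<bar>D s\<bar> * P s s')" .
  qed
  also have "\<dots> = ?\<beta> * (\<Sum>s\<in>UNIV. \<bar>D s\<bar>)"
  proof -
    have "(\<Sum>s'\<in>UNIV. \<Sum>s\<in>UNIV. \<bar>D s\<bar> * P s s') = (\<Sum>s\<in>UNIV. \<bar>D s\<bar>)"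
      by (subst sum.swap) (simp add: P1 flip: sum_distrib_left)
    then show ?thesis by (simp flip: sum_distrib_left)
  qed
  finally have "(1 - ?\<beta>) * (\<Sum>s\<in>UNIV. \<bar>D s\<bar>) \<le> 0" by (simp add: algebra_simps)
  then have "(\<Sum>s\<in>UNIV. \<bar>D s\<bar>) \<le> 0" using \<beta> by (simp add: mult_le_0_iff)
  then have "(\<Sum>s\<in>UNIV. \<bar>D s\<bar>) = 0" by (simp add: antisym sum_nonneg)
  then have "D s = 0" by (simp add: sum_nonneg_eq_0_iff)
  then show ?thesis by (simp add: D_def)
qed

lemma stationary2_behavioral2: "g \<in> stationary2 G \<Longrightarrow> (\<lambda>_. g) \<in> behavioral2 G"
  by (simp add: stationary2_def behavioral2_def)

lemma occupation_stationary:
  assumes "valid_game G"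
  shows "occupation G f (\<lambda>_. g) s b =
    ((1 - disc G) * (\<Sum>t. disc G ^ t * pmf (state_law G f (\<lambda>_. g) t) s)) * pmf (g s) b"
proof -
  have "pmf (state_action_law G f (\<lambda>_. g) t) (s, b) =
      pmf (state_law G f (\<lambda>_. g) t) s * pmf (g s) b" for t
  proof -
    have "state_action_law G f (\<lambda>_. g) t =
        bind_pmf (state_law G f (\<lambda>_. g) t) (\<lambda>s. map_pmf (Pair s) (g s))"
      by (simp add: state_action_law_def state_law_def bind_map_pmf case_prod_unfold)
    moreover have "pmf (map_pmf (Pair s') (g s')) (s, b) =
        pmf (g s) b * indicator {s} s'" for s'
    proof (cases "s' = s")
      case True
      then show ?thesis using pmf_map_inj'[of "Pair s" "g s" b] by (simp add: inj_on_def)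
    next
      case False
      then show ?thesis by (auto simp: pmf_eq_0_set_pmf)
    qed
    ultimately show ?thesis by (simp add: pmf_bind measure_pmf_single)
  qed
  then show ?thesis
    by (simp add: occupation_def suminf_mult2[OF summable_discounted_pmf[OF assms]] mult.assoc)
qed

text \<open>
  The occupation measure of \<open>g\<close> also factors through \<open>g\<close> and balances the flow, so it coincides with
  \<open>x\<close> by uniqueness. In particular it is the same for every strategy \<open>f\<close> of player 1, which turns
  player 1's best response into a linear program with the fixed data \<open>x\<close>.
\<close>

lemma discounted_stationary:
  assumes "valid_game G" "f \<in> stationary1 G" "g \<in> stationary2 G" "flow_balance G x"
    and x: "\<And>s b. b \<in> act2 G s \<Longrightarrow> x s b = X s * pmf (g s) b"
  shows "discounted G c f (\<lambda>_. g) = total_cost G c (\<lambda>s. pmf (f s)) x"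
proof -
  note gh = stationary2_behavioral2[OF assms(3)]
  have "occupation G f (\<lambda>_. g) s b = x s b" if "b \<in> act2 G s" for s b
    using flow_balance_unique[OF assms(1,3) flow_balance_occupation[OF assms(1,2) gh] assms(4)
        occupation_stationary[OF assms(1)] x, of s] x[OF that] occupation_stationary[OF assms(1)]
    by simp
  then show ?thesis
    by (simp add: discounted_eq_total_cost[OF assms(1,2) gh] total_cost_def)
qed

section \<open>The two best-response programs\<close>

text \<open>
  The index \<open>1\<close> or \<open>2\<close> names the player whose best-response program is meant. Player 1 chooses \<open>f\<close> given
  \<open>x\<close>; the dual variables \<open>z\<close> price the normalisations of \<open>f\<close> and \<open>d\<close> the subscription constraints.
  Player 2 chooses \<open>x\<close> given \<open>f\<close>; the dual variables \<open>u\<close> price the flow equations, which makes the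
  dual constraint a Bellman inequality, and \<open>d\<close> the cost constraints.
\<close>

definition primal1 :: "('s::finite, 'a, 'b) game \<Rightarrow> ('s \<Rightarrow> 'a \<Rightarrow> real) \<Rightarrow> bool" where
  "primal1 G f \<longleftrightarrow>
     (\<forall>s. \<forall>a\<in>act1 G s. 0 \<le> f s a) \<and> (\<forall>s. (\<Sum>a\<in>act1 G s. f s a) = 1) \<and>
     (\<forall>k\<in>{1..num1 G}. (\<Sum>s\<in>UNIV. \<Sum>a\<in>act1 G s. dsub1 G k s a * f s a) \<le> bound1 G k)"

definition dual1 ::
  "('s::finite, 'a, 'b) game \<Rightarrow> ('s \<Rightarrow> 'b \<Rightarrow> real) \<Rightarrow> ('s \<Rightarrow> real) \<Rightarrow> (nat \<Rightarrow> real) \<Rightarrow> bool" where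
  "dual1 G x z d \<longleftrightarrow>
     (\<forall>k\<in>{1..num1 G}. 0 \<le> d k) \<and>
     (\<forall>s. \<forall>a\<in>act1 G s. z s \<le> (\<Sum>b\<in>act2 G s. cost1 G s a b * x s b)
        + (\<Sum>k=1..num1 G. d k * dsub1 G k s a))"

definition dual_value1 :: "('s::finite, 'a, 'b) game \<Rightarrow> ('s \<Rightarrow> real) \<Rightarrow> (nat \<Rightarrow> real) \<Rightarrow> real" where
  "dual_value1 G z d = (\<Sum>s\<in>UNIV. z s) - (\<Sum>k=1..num1 G. d k * bound1 G k)"

definition primal2 ::
  "('s::finite, 'a, 'b) game \<Rightarrow> ('s \<Rightarrow> 'a \<Rightarrow> real) \<Rightarrow> ('s \<Rightarrow> 'b \<Rightarrow> real) \<Rightarrow> bool" where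
  "primal2 G f x \<longleftrightarrow>
     (\<forall>s. \<forall>b\<in>act2 G s. 0 \<le> x s b) \<and> flow_balance G x \<and>
     (\<forall>l\<in>{1..num2 G}. total_cost G (dcost2 G l) f x \<le> bound2 G l)"

definition dual2 ::
  "('s::finite, 'a, 'b) game \<Rightarrow> ('s \<Rightarrow> 'a \<Rightarrow> real) \<Rightarrow> ('s \<Rightarrow> real) \<Rightarrow> (nat \<Rightarrow> real) \<Rightarrow> bool" where
  "dual2 G f u d \<longleftrightarrow>
     (\<forall>l\<in>{1..num2 G}. 0 \<le> d l) \<and>
     (\<forall>s. \<forall>b\<in>act2 G s. u s \<le> (\<Sum>a\<in>act1 G s. f s a * cost2 G s a b)
        + (\<Sum>l=1..num2 G. d l * (\<Sum>a\<in>act1 G s. f s a * dcost2 G l s a b))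
        + disc G * (\<Sum>s'\<in>UNIV. pmf (transition G s b) s' * u s'))"

definition dual_value2 :: "('s::finite, 'a, 'b) game \<Rightarrow> ('s \<Rightarrow> real) \<Rightarrow> (nat \<Rightarrow> real) \<Rightarrow> real" where
  "dual_value2 G u d =
     (1 - disc G) * (\<Sum>s\<in>UNIV. pmf (init G) s * u s) - (\<Sum>l=1..num2 G. d l * bound2 G l)"

lemma mp_feasible_iff:
  "mp_feasible G \<eta> \<longleftrightarrow>
     primal1 G (vec_f \<eta>) \<and> dual1 G (vec_x \<eta>) (vec_z \<eta>) (vec_d1 \<eta>) \<and>
     primal2 G (vec_f \<eta>) (vec_x \<eta>) \<and> dual2 G (vec_f \<eta>) (vec_u \<eta>) (vec_d2 \<eta>)"
  unfolding mp_feasible_def primal1_def dual1_def primal2_def dual2_def flow_balance_def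
    total_cost_def
  by blast

lemma mp_objective_eq:
  "mp_objective G \<eta> =
     (total_cost G (cost1 G) (vec_f \<eta>) (vec_x \<eta>) - dual_value1 G (vec_z \<eta>) (vec_d1 \<eta>)) +
     (total_cost G (cost2 G) (vec_f \<eta>) (vec_x \<eta>) - dual_value2 G (vec_u \<eta>) (vec_d2 \<eta>))"
  by (simp add: mp_objective_def total_cost_def dual_value1_def dual_value2_def)

lemma sum_Sigma_UNIV:
  fixes A :: "'s::finite \<Rightarrow> 'a set"
  assumes "\<And>s. finite (A s)"
  shows "(\<Sum>j\<in>Sigma UNIV A. F j) = (\<Sum>s\<in>UNIV. \<Sum>a\<in>A s. F (s, a))"
  using assms by (subst sum.Sigma) auto

text \<open>
  To apply the general duality theorems, each program is written over the flat index set of admissible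
  state-action pairs; the summations over states and actions then have to be merged.
\<close>

lemma primal1_iff_lp:
  assumes "valid_game G"
  shows "primal1 G f \<longleftrightarrow> lp_primal (Sigma UNIV (act1 G)) UNIV {1..num1 G}
    (\<lambda>s j. of_bool (fst j = s)) (\<lambda>_. 1) (\<lambda>k (s, a). dsub1 G k s a) (bound1 G) (\<lambda>(s, a). f s a)"
proof -
  have fin: "finite (act1 G s)" for s using assms by (auto simp: valid_game_def)
  show ?thesis
    unfolding primal1_def lp_primal_def sum_Sigma_UNIV[OF fin]
    by (auto simp flip: sum_distrib_left)
qed

lemma dual1_iff_lp:
  "dual1 G x z d \<longleftrightarrow> lp_dual (Sigma UNIV (act1 G)) UNIV {1..num1 G}
    (\<lambda>s j. of_bool (fst j = s)) (\<lambda>k (s, a). dsub1 G k s a)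
    (\<lambda>(s, a). \<Sum>b\<in>act2 G s. cost1 G s a b * x s b) z d"
  by (auto simp: dual1_def lp_dual_def)

lemma total_cost_flat1:
  assumes "valid_game G"
  shows "total_cost G c f x =
    (\<Sum>j\<in>Sigma UNIV (act1 G).
       (case j of (s, a) \<Rightarrow> \<Sum>b\<in>act2 G s. c s a b * x s b) * (case j of (s, a) \<Rightarrow> f s a))"
proof -
  have fin: "finite (act1 G s)" for s using assms by (auto simp: valid_game_def)
  show ?thesis
    by (simp add: total_cost_def sum_Sigma_UNIV fin sum_distrib_left sum_distrib_right mult_ac)
qed


lemma total_cost_flat2:
  assumes "valid_game G"
  shows "total_cost G c f x =
    (\<Sum>j\<in>Sigma UNIV (act2 G).
       (case j of (s, b) \<Rightarrow> \<Sum>a\<in>act1 G s. f s a * c s a b) * (case j of (s, b) \<Rightarrow> x s b))"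
proof -
  have fin: "finite (act2 G s)" for s using assms by (auto simp: valid_game_def)
  have "total_cost G c f x = (\<Sum>s\<in>UNIV. \<Sum>b\<in>act2 G s. \<Sum>a\<in>act1 G s. f s a * c s a b * x s b)"
    unfolding total_cost_def by (intro sum.cong refl sum.swap)
  then show ?thesis
    by (simp add: sum_Sigma_UNIV fin sum_distrib_right)
qed

lemma primal2_iff_lp:
  assumes "valid_game G"
  shows "primal2 G f x \<longleftrightarrow> lp_primal (Sigma UNIV (act2 G)) UNIV {1..num2 G}
    (\<lambda>s' (s, b). of_bool (s = s') - disc G * pmf (transition G s b) s')
    (\<lambda>s'. (1 - disc G) * pmf (init G) s')
    (\<lambda>l (s, b). \<Sum>a\<in>act1 G s. f s a * dcost2 G l s a b) (bound2 G) (\<lambda>(s, b). x s b)"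
proof -
  have fin: "finite (act2 G s)" for s using assms by (auto simp: valid_game_def)
  show ?thesis
    unfolding primal2_def lp_primal_def flow_balance_def total_cost_flat2[OF assms]
    by (auto simp: sum_Sigma_UNIV fin)
qed

lemma dual2_iff_lp:
  "dual2 G f u d \<longleftrightarrow> lp_dual (Sigma UNIV (act2 G)) UNIV {1..num2 G}
    (\<lambda>s' (s, b). of_bool (s = s') - disc G * pmf (transition G s b) s')
    (\<lambda>l (s, b). \<Sum>a\<in>act1 G s. f s a * dcost2 G l s a b)
    (\<lambda>(s, b). \<Sum>a\<in>act1 G s. f s a * cost2 G s a b) u d"
proof -
  have eq: "(\<Sum>s'\<in>UNIV. u s' * (of_bool (s = s') - disc G * pmf (transition G s b) s')) =
      u s - disc G * (\<Sum>s'\<in>UNIV. pmf (transition G s b) s' * u s')" for s b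
    by (simp add: right_diff_distrib sum_subtractf sum_distrib_left mult_ac)
  show ?thesis
    by (auto simp: dual2_def lp_dual_def eq diff_le_eq)
qed

lemma dual_value2_flat:
  "dual_value2 G u d =
     (\<Sum>s\<in>UNIV. u s * ((1 - disc G) * pmf (init G) s)) - (\<Sum>l=1..num2 G. d l * bound2 G l)"
  by (simp add: dual_value2_def sum_distrib_left mult_ac)

lemma weak_duality1:
  assumes "valid_game G" "primal1 G f" "dual1 G x z d"
  shows "dual_value1 G z d \<le> total_cost G (cost1 G) f x"
  using lp_weak_duality[OF assms(2)[unfolded primal1_iff_lp[OF assms(1)]]
      assms(3)[unfolded dual1_iff_lp]]
  by (simp add: total_cost_flat1[OF assms(1)] dual_value1_def)

lemma weak_duality2:
  assumes "valid_game G" "primal2 G f x" "dual2 G f u d"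
  shows "dual_value2 G u d \<le> total_cost G (cost2 G) f x"
  using lp_weak_duality[OF assms(2)[unfolded primal2_iff_lp[OF assms(1)]]
      assms(3)[unfolded dual2_iff_lp]]
  by (simp only: total_cost_flat2[OF assms(1)] dual_value2_flat)

lemma strong_duality1:
  assumes "valid_game G" "primal1 G f"
    and opt: "\<And>f'. primal1 G f' \<Longrightarrow> total_cost G (cost1 G) f x \<le> total_cost G (cost1 G) f' x"
  shows "\<exists>z d. dual1 G x z d \<and> dual_value1 G z d = total_cost G (cost1 G) f x"
  unfolding dual1_iff_lp dual_value1_def total_cost_flat1[OF assms(1)]
proof (rule lp_strong_duality[where b = "\<lambda>_. 1", simplified mult_1_right])
  show "finite (Sigma UNIV (act1 G))" using assms(1) by (auto simp: valid_game_def)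
  show "lp_primal (Sigma UNIV (act1 G)) UNIV {1..num1 G} (\<lambda>s j. of_bool (fst j = s)) (\<lambda>_. 1)
      (\<lambda>k (s, a). dsub1 G k s a) (bound1 G) (\<lambda>(s, a). f s a)"
    using assms(2) by (simp only: primal1_iff_lp[OF assms(1)])
  fix f'
  assume "lp_primal (Sigma UNIV (act1 G)) UNIV {1..num1 G} (\<lambda>s j. of_bool (fst j = s)) (\<lambda>_. 1)
      (\<lambda>k (s, a). dsub1 G k s a) (bound1 G) f'"
  then have "primal1 G (curry f')" by (simp add: primal1_iff_lp[OF assms(1)])
  from opt[OF this]
  show "(\<Sum>j\<in>Sigma UNIV (act1 G). (case j of (s, a) \<Rightarrow> \<Sum>b\<in>act2 G s. cost1 G s a b * x s b) *
        (case j of (s, a) \<Rightarrow> f s a))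
      \<le> (\<Sum>j\<in>Sigma UNIV (act1 G). (case j of (s, a) \<Rightarrow> \<Sum>b\<in>act2 G s. cost1 G s a b * x s b) *
        f' j)"
    by (simp add: total_cost_flat1[OF assms(1)])
qed simp_all

lemma strong_duality2:
  assumes "valid_game G" "primal2 G f x"
    and opt: "\<And>x'. primal2 G f x' \<Longrightarrow> total_cost G (cost2 G) f x \<le> total_cost G (cost2 G) f x'"
  shows "\<exists>u d. dual2 G f u d \<and> dual_value2 G u d = total_cost G (cost2 G) f x"
  unfolding dual2_iff_lp dual_value2_flat total_cost_flat2[OF assms(1)]
proof (rule lp_strong_duality)
  show "finite (Sigma UNIV (act2 G))" using assms(1) by (auto simp: valid_game_def)
  show "lp_primal (Sigma UNIV (act2 G)) UNIV {1..num2 G}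
      (\<lambda>s' (s, b). of_bool (s = s') - disc G * pmf (transition G s b) s')
      (\<lambda>s'. (1 - disc G) * pmf (init G) s')
      (\<lambda>l (s, b). \<Sum>a\<in>act1 G s. f s a * dcost2 G l s a b) (bound2 G) (\<lambda>(s, b). x s b)"
    using assms(2) by (simp only: primal2_iff_lp[OF assms(1)])
  fix x'
  assume "lp_primal (Sigma UNIV (act2 G)) UNIV {1..num2 G}
      (\<lambda>s' (s, b). of_bool (s = s') - disc G * pmf (transition G s b) s')
      (\<lambda>s'. (1 - disc G) * pmf (init G) s')
      (\<lambda>l (s, b). \<Sum>a\<in>act1 G s. f s a * dcost2 G l s a b) (bound2 G) x'"
  then have "primal2 G f (curry x')" by (simp add: primal2_iff_lp[OF assms(1)])
  from opt[OF this]
  show "(\<Sum>j\<in>Sigma UNIV (act2 G). (case j of (s, b) \<Rightarrow> \<Sum>a\<in>act1 G s. f s a * cost2 G s a b) *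
        (case j of (s, b) \<Rightarrow> x s b))
      \<le> (\<Sum>j\<in>Sigma UNIV (act2 G). (case j of (s, b) \<Rightarrow> \<Sum>a\<in>act1 G s. f s a * cost2 G s a b) *
        x' j)"
    by (simp add: total_cost_flat2[OF assms(1)])
qed simp_all

lemma pmf_of_finite_weights:
  fixes h :: "'a \<Rightarrow> real"
  assumes "finite A" "\<And>a. a \<in> A \<Longrightarrow> 0 \<le> h a" "(\<Sum>a\<in>A. h a) = 1"
  shows "\<exists>p. set_pmf p \<subseteq> A \<and> (\<forall>a\<in>A. pmf p a = h a)"
proof -
  define w where "w a = (if a \<in> A then h a else 0)" for a
  have w0: "0 \<le> w a" for a using assms(2) by (simp add: w_def)
  have "(\<integral>\<^sup>+ a. ennreal (w a) \<partial>count_space UNIV) = (\<Sum>a\<in>A. ennreal (w a))"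
    using assms(1) by (intro nn_integral_count_space') (auto simp: w_def)
  also have "\<dots> = ennreal (\<Sum>a\<in>A. w a)" using w0 by simp
  also have "\<dots> = 1" using assms(3) by (simp add: w_def)
  finally have "pmf (embed_pmf w) a = w a" for a
    using w0 by (simp add: pmf_embed_pmf)
  then show ?thesis
    by (intro exI[of _ "embed_pmf w"]) (auto simp: set_pmf_eq w_def)
qed

lemma strategy_of_weights:
  fixes h :: "'s \<Rightarrow> 'a \<Rightarrow> real"
  assumes "\<And>s. finite (A s)" "\<And>s a. a \<in> A s \<Longrightarrow> 0 \<le> h s a" "\<And>s. (\<Sum>a\<in>A s. h s a) = 1"
  shows "\<exists>p. \<forall>s. set_pmf (p s) \<subseteq> A s \<and> (\<forall>a\<in>A s. pmf (p s) a = h s a)"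
  using pmf_of_finite_weights[of "A s" "h s" for s] assms by (intro choice) blast

lemma total_cost_cong:
  assumes "\<And>s a. a \<in> act1 G s \<Longrightarrow> f s a = f' s a" "\<And>s b. b \<in> act2 G s \<Longrightarrow> x s b = x' s b"
  shows "total_cost G c f x = total_cost G c f' x'"
  unfolding total_cost_def using assms by (intro sum.cong) auto

lemma primal1_pmf_iff:
  assumes "valid_game G" "f \<in> stationary1 G"
  shows "primal1 G (\<lambda>s. pmf (f s)) \<longleftrightarrow> feasible1 G f"
proof -
  have "(\<Sum>a\<in>act1 G s. pmf (f s) a) = 1" for s
    using assms by (intro sum_pmf_eq_1) (auto simp: valid_game_def stationary1_def)
  then show ?thesis by (simp add: primal1_def feasible1_def)
qed

lemma stationary1_of_primal1:
  assumes "valid_game G" "primal1 G f"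
  shows "\<exists>p\<in>stationary1 G. \<forall>s. \<forall>a\<in>act1 G s. pmf (p s) a = f s a"
  using strategy_of_weights[of "act1 G" f] assms
  by (auto simp: valid_game_def primal1_def stationary1_def)

text \<open>
  At states of mass \<open>0\<close> the strategy is unconstrained and a point mass serves.
\<close>

lemma stationary2_normalizing:
  assumes "valid_game G" "\<And>s b. b \<in> act2 G s \<Longrightarrow> 0 \<le> x s b"
  shows "\<exists>g\<in>stationary2 G. \<forall>s. (\<Sum>b\<in>act2 G s. x s b) \<noteq> 0 \<longrightarrow>
    (\<forall>b\<in>act2 G s. pmf (g s) b = x s b / (\<Sum>b'\<in>act2 G s. x s b'))"
proof -
  have fin: "finite (act2 G s)" "act2 G s \<noteq> {}" for s using assms(1) by (auto simp: valid_game_def)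
  have "\<exists>p. set_pmf p \<subseteq> act2 G s \<and> ((\<Sum>b\<in>act2 G s. x s b) \<noteq> 0 \<longrightarrow>
    (\<forall>b\<in>act2 G s. pmf p b = x s b / (\<Sum>b'\<in>act2 G s. x s b')))" for s
  proof (cases "(\<Sum>b\<in>act2 G s. x s b) = 0")
    case True
    obtain b where "b \<in> act2 G s" using fin by blast
    with True show ?thesis by (intro exI[of _ "return_pmf b"]) simp
  next
    case False
    have "(\<Sum>b\<in>act2 G s. x s b / (\<Sum>b'\<in>act2 G s. x s b')) = 1"
      using False by (simp flip: sum_divide_distrib)
    then have "\<exists>p. set_pmf p \<subseteq> act2 G s \<and>
        (\<forall>b\<in>act2 G s. pmf p b = x s b / (\<Sum>b'\<in>act2 G s. x s b'))"
      using fin assms(2) by (intro pmf_of_finite_weights divide_nonneg_nonneg sum_nonneg) auto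
    then show ?thesis by blast
  qed
  then have "\<exists>g. \<forall>s. set_pmf (g s) \<subseteq> act2 G s \<and> ((\<Sum>b\<in>act2 G s. x s b) \<noteq> 0 \<longrightarrow>
    (\<forall>b\<in>act2 G s. pmf (g s) b = x s b / (\<Sum>b'\<in>act2 G s. x s b')))"
    by (intro choice) blast
  then show ?thesis by (auto simp: stationary2_def)
qed

text \<open>
  Where the total mass vanishes so does \<open>x\<close>, by nonnegativity, so the factorization holds for any
  choice of \<open>g\<close> at such states.
\<close>

lemma normalizing_factorization:
  assumes "valid_game G" "\<And>s b. b \<in> act2 G s \<Longrightarrow> 0 \<le> x s b"
    and "\<And>s. (\<Sum>b\<in>act2 G s. x s b) \<noteq> 0 \<Longrightarrow>
      \<forall>b\<in>act2 G s. pmf (g s) b = x s b / (\<Sum>b'\<in>act2 G s. x s b')"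
    and "b \<in> act2 G s"
  shows "x s b = (\<Sum>b'\<in>act2 G s. x s b') * pmf (g s) b"
proof (cases "(\<Sum>b'\<in>act2 G s. x s b') = 0")
  case True
  have "finite (act2 G s)" using assms(1) by (auto simp: valid_game_def)
  then have "x s b = 0"
    using True assms(2,4) by (subst (asm) sum_nonneg_eq_0_iff) auto
  with True show ?thesis by simp
next
  case False
  with assms(3)[OF False] assms(4) show ?thesis by simp
qed

lemma primal2_occupation_iff:
  assumes "valid_game G" "f \<in> stationary1 G" "gh \<in> behavioral2 G"
  shows "primal2 G (\<lambda>s. pmf (f s)) (occupation G f gh) \<longleftrightarrow> feasible2 G f gh"
  using flow_balance_occupation[OF assms] occupation_nonneg[OF assms(1)]
  by (simp add: primal2_def feasible2_def discounted_eq_total_cost[OF assms])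

section \<open>Equilibria and zeros of the objective\<close>

lemma mp_objective_nonneg:
  assumes "valid_game G" "mp_feasible G \<eta>"
  shows "0 \<le> mp_objective G \<eta>"
  using weak_duality1[OF assms(1)] weak_duality2[OF assms(1)] assms(2)
  by (fastforce simp: mp_feasible_iff mp_objective_eq)

text \<open>
  Feasible points of player 1's program are the feasible stationary strategies, and a deviation of
  player 1 does not change the occupation measure, so the equilibrium inequality is optimality in the
  program.
\<close>

lemma nash_optimal1:
  assumes "valid_game G" "nash_equilibrium G f g" "primal1 G f'"
  shows "total_cost G (cost1 G) (\<lambda>s. pmf (f s)) (occupation G f (\<lambda>_. g))
    \<le> total_cost G (cost1 G) f' (occupation G f (\<lambda>_. g))"
proof -
  let ?x = "occupation G f (\<lambda>_. g)"
  have f: "f \<in> stationary1 G" and g: "g \<in> stationary2 G"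
    using assms(2) by (auto simp: nash_equilibrium_def)
  note flow = flow_balance_occupation[OF assms(1) f stationary2_behavioral2[OF g]]
  obtain p where p: "p \<in> stationary1 G" "\<And>s a. a \<in> act1 G s \<Longrightarrow> pmf (p s) a = f' s a"
    using stationary1_of_primal1[OF assms(1,3)] by blast
  have "primal1 G (\<lambda>s. pmf (p s))" using assms(3) p(2) by (simp add: primal1_def)
  then have "feasible1 G p" using primal1_pmf_iff[OF assms(1) p(1)] by simp
  then have "discounted G (cost1 G) f (\<lambda>_. g) \<le> discounted G (cost1 G) p (\<lambda>_. g)"
    using assms(2) p(1) by (simp add: nash_equilibrium_def)
  then have "total_cost G (cost1 G) (\<lambda>s. pmf (f s)) ?x
      \<le> total_cost G (cost1 G) (\<lambda>s. pmf (p s)) ?x"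
    by (simp add: discounted_stationary[OF assms(1) _ g flow occupation_stationary[OF assms(1)]]
        f p(1))
  then show ?thesis using total_cost_cong[of G "\<lambda>s. pmf (p s)" f' ?x ?x, OF p(2)] by simp
qed

text \<open>
  A feasible \<open>x\<close> is realised by the stationary strategy obtained by normalising it, so the equilibrium
  inequality applies to it.
\<close>

lemma nash_optimal2:
  assumes "valid_game G" "nash_equilibrium G f g" "primal2 G (\<lambda>s. pmf (f s)) x"
  shows "total_cost G (cost2 G) (\<lambda>s. pmf (f s)) (occupation G f (\<lambda>_. g))
    \<le> total_cost G (cost2 G) (\<lambda>s. pmf (f s)) x"
proof -
  have f: "f \<in> stationary1 G" and g: "g \<in> stationary2 G"
    using assms(2) by (auto simp: nash_equilibrium_def)
  have x: "\<And>s b. b \<in> act2 G s \<Longrightarrow> 0 \<le> x s b" "flow_balance G x"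
    using assms(3) by (auto simp: primal2_def)
  obtain g' where g': "g' \<in> stationary2 G"
      and norm: "\<And>s. (\<Sum>b\<in>act2 G s. x s b) \<noteq> 0 \<Longrightarrow>
        \<forall>b\<in>act2 G s. pmf (g' s) b = x s b / (\<Sum>b'\<in>act2 G s. x s b')"
    using stationary2_normalizing[where x = x, OF assms(1) x(1)] by blast
  note val = discounted_stationary[OF assms(1) f g' x(2)
      normalizing_factorization[where x = x, OF assms(1) x(1) norm]]
  have "feasible2 G f (\<lambda>_. g')"
    using assms(3) by (simp add: feasible2_def val primal2_def)
  then have "discounted G (cost2 G) f (\<lambda>_. g) \<le> discounted G (cost2 G) f (\<lambda>_. g')"
    using assms(2) stationary2_behavioral2[OF g'] by (simp add: nash_equilibrium_def)
  then show ?thesis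
    by (simp add: val discounted_eq_total_cost[OF assms(1) f stationary2_behavioral2[OF g]])
qed

text \<open>
  Both primal points are optimal, so strong duality closes both gaps; a feasible point of value \<open>0\<close> is
  a global minimum because the objective is never negative.
\<close>

lemma nash_imp_zero_minimum:
  assumes "valid_game G" "nash_equilibrium G f g"
  shows "\<exists>\<eta>. has_f_component G \<eta> f \<and> mp_global_min G \<eta> \<and> mp_objective G \<eta> = 0"
proof -
  let ?x = "occupation G f (\<lambda>_. g)" and ?f = "\<lambda>s. pmf (f s)"
  have f: "f \<in> stationary1 G" and g: "g \<in> stationary2 G"
    and feas: "feasible1 G f" "feasible2 G f (\<lambda>_. g)"
    using assms(2) by (auto simp: nash_equilibrium_def feasible_pair_def)
  have p1: "primal1 G ?f" using primal1_pmf_iff[OF assms(1) f] feas(1) by simp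
  have p2: "primal2 G ?f ?x"
    using primal2_occupation_iff[OF assms(1) f stationary2_behavioral2[OF g]] feas(2) by simp
  obtain z d1 where d1: "dual1 G ?x z d1" "dual_value1 G z d1 = total_cost G (cost1 G) ?f ?x"
    using strong_duality1[OF assms(1) p1 nash_optimal1[OF assms]] by blast
  obtain u d2 where d2: "dual2 G ?f u d2" "dual_value2 G u d2 = total_cost G (cost2 G) ?f ?x"
    using strong_duality2[OF assms(1) p2 nash_optimal2[OF assms]] by blast
  define \<eta> where
    "\<eta> = \<lparr>vec_u = u, vec_z = z, vec_f = ?f, vec_x = ?x, vec_d1 = d1, vec_d2 = d2\<rparr>"
  have "mp_feasible G \<eta>" using p1 p2 d1(1) d2(1) by (simp add: mp_feasible_iff \<eta>_def)
  moreover have "mp_objective G \<eta> = 0" using d1(2) d2(2) by (simp add: mp_objective_eq \<eta>_def)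
  moreover have "has_f_component G \<eta> f" by (simp add: has_f_component_def \<eta>_def)
  ultimately show ?thesis
    using mp_objective_nonneg[OF assms(1)] by (auto simp: mp_global_min_def)
qed

text \<open>
  Two nonnegative gaps with sum \<open>0\<close> both vanish, so the dual values are attained by \<open>(f, g)\<close>. Weak
  duality bounds the cost of every feasible deviation from below by the same dual value; the
  deviations of player 2 enter through their occupation measures.
\<close>

lemma zero_feasible_imp_nash:
  assumes "valid_game G" "mp_feasible G \<eta>" "mp_objective G \<eta> = 0"
    and f: "f \<in> stationary1 G" "has_f_component G \<eta> f"
    and g: "g \<in> stationary2 G" "normalizes_x_component G \<eta> g"
  shows "nash_equilibrium G f g"
proof -
  let ?f = "\<lambda>s. pmf (f s)" and ?x = "vec_x \<eta>"
  have feas: "primal1 G (vec_f \<eta>)" "dual1 G ?x (vec_z \<eta>) (vec_d1 \<eta>)"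
      "primal2 G (vec_f \<eta>) ?x" "dual2 G (vec_f \<eta>) (vec_u \<eta>) (vec_d2 \<eta>)"
    using assms(2) by (auto simp: mp_feasible_iff)
  have fc: "vec_f \<eta> s a = ?f s a" if "a \<in> act1 G s" for s a
    using f(2) that by (simp add: has_f_component_def)
  have tc: "total_cost G c (vec_f \<eta>) x = total_cost G c ?f x" for c x
    using fc by (intro total_cost_cong) auto
  have x: "\<And>s b. b \<in> act2 G s \<Longrightarrow> 0 \<le> ?x s b" "flow_balance G ?x"
    using feas(3) by (auto simp: primal2_def)
  have val: "discounted G c f' (\<lambda>_. g) = total_cost G c (\<lambda>s. pmf (f' s)) ?x"
    if "f' \<in> stationary1 G" for c f'
  proof (rule discounted_stationary[OF assms(1) that g(1) x(2)])
    show "?x s b = (\<Sum>b'\<in>act2 G s. ?x s b') * pmf (g s) b" if "b \<in> act2 G s" for s b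
      using g(2) that unfolding normalizes_x_component_def
      by (intro normalizing_factorization[OF assms(1) x(1)]) auto
  qed
  have opt: "total_cost G (cost1 G) ?f ?x = dual_value1 G (vec_z \<eta>) (vec_d1 \<eta>)"
      "total_cost G (cost2 G) ?f ?x = dual_value2 G (vec_u \<eta>) (vec_d2 \<eta>)"
    using weak_duality1[OF assms(1) feas(1,2)] weak_duality2[OF assms(1) feas(3,4)] assms(3)
    by (simp_all add: mp_objective_eq tc)
  have "primal1 G ?f" using feas(1) fc by (simp add: primal1_def)
  then have "feasible1 G f" using primal1_pmf_iff[OF assms(1) f(1)] by simp
  moreover have "feasible2 G f (\<lambda>_. g)"
    using feas(3) by (simp add: feasible2_def val[OF f(1)] primal2_def tc)
  moreover have "discounted G (cost1 G) f (\<lambda>_. g) \<le> discounted G (cost1 G) f' (\<lambda>_. g)"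
    if "f' \<in> stationary1 G" "feasible1 G f'" for f'
    using weak_duality1[OF assms(1) _ feas(2)] primal1_pmf_iff[OF assms(1) that(1)] that(2)
    by (simp add: val f(1) that(1) opt(1))
  moreover have "discounted G (cost2 G) f (\<lambda>_. g) \<le> discounted G (cost2 G) f gh"
    if "gh \<in> behavioral2 G" "feasible2 G f gh" for gh
  proof -
    have "primal2 G ?f (occupation G f gh)"
      using primal2_occupation_iff[OF assms(1) f(1) that(1)] that(2) by simp
    then have "primal2 G (vec_f \<eta>) (occupation G f gh)" by (simp add: primal2_def tc)
    from weak_duality2[OF assms(1) this feas(4)] show ?thesis
      by (simp add: val f(1) tc opt(2) discounted_eq_total_cost[OF assms(1) f(1) that(1)])
  qed
  ultimately show ?thesis
    using f(1) g(1) by (simp add: nash_equilibrium_def feasible_pair_def)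
qed

theorem theorem2:
  fixes G :: "('s::finite, 'a, 'b) game"
  assumes "valid_game G"
    and "\<exists>f\<in>stationary1 G. \<exists>g\<in>stationary2 G. feasible_pair G f g"
    and "strong_slater G"
  shows "(\<forall>f g. nash_equilibrium G f g \<longrightarrow>
            (\<exists>\<eta>. has_f_component G \<eta> f \<and> mp_global_min G \<eta> \<and> mp_objective G \<eta> = 0)) \<and>
         (\<forall>\<eta>. mp_global_min G \<eta> \<and> mp_objective G \<eta> = 0 \<longrightarrow>
            (\<exists>f\<in>stationary1 G. has_f_component G \<eta> f) \<and>
            (\<exists>g\<in>stationary2 G. normalizes_x_component G \<eta> g) \<and>
            (\<forall>f\<in>stationary1 G. \<forall>g\<in>stationary2 G.
               has_f_component G \<eta> f \<and> normalizes_x_component G \<eta> g \<longrightarrow>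
               nash_equilibrium G f g))"
proof (intro conjI allI impI)
  show "\<exists>\<eta>. has_f_component G \<eta> f \<and> mp_global_min G \<eta> \<and> mp_objective G \<eta> = 0"
    if "nash_equilibrium G f g" for f g
    using nash_imp_zero_minimum[OF assms(1) that] .
next
  fix \<eta>
  assume "mp_global_min G \<eta> \<and> mp_objective G \<eta> = 0"
  then have feas: "mp_feasible G \<eta>" and zero: "mp_objective G \<eta> = 0"
    by (auto simp: mp_global_min_def)
  from feas have p1: "primal1 G (vec_f \<eta>)" and x: "\<And>s b. b \<in> act2 G s \<Longrightarrow> 0 \<le> vec_x \<eta> s b"
    by (auto simp: mp_feasible_iff primal2_def)
  show "\<exists>f\<in>stationary1 G. has_f_component G \<eta> f"
    using stationary1_of_primal1[OF assms(1) p1] by (simp add: has_f_component_def eq_commute)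
  show "\<exists>g\<in>stationary2 G. normalizes_x_component G \<eta> g"
    using stationary2_normalizing[where x = "vec_x \<eta>", OF assms(1) x] by (simp add: normalizes_x_component_def)
  show "\<forall>f\<in>stationary1 G. \<forall>g\<in>stationary2 G.
      has_f_component G \<eta> f \<and> normalizes_x_component G \<eta> g \<longrightarrow> nash_equilibrium G f g"
    using zero_feasible_imp_nash[OF assms(1) feas zero] by blast
qed

end
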